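(* Let $Q_1,Q_2$ be channels from $\mathcal{H}$ to $\mathcal{K}$ given by $Q_i(\rho)=\operatorname{tr}_{\mathcal{B}}U_i(\rho\otimes|0\rangle\langle0|)U_i^*$ for $i=1,2$, where $U_1,U_2$ are unitary maps from $\mathcal{H}\otimes\mathcal{A}$ to $\mathcal{K}\otimes\mathcal{B}$ and $|0\rangle\in\mathcal{A}$. Let $\mathcal{Q}$ be a two-dimensional space and $V$ the unitary on $\mathcal{Q}\otimes\mathcal{H}\otimes\mathcal{A}$ defined by $V(|0\rangle\otimes|\psi\rangle)=|0\rangle\otimes U_1|\psi\rangle$ and $V(|1\rangle\otimes|\psi\rangle)=|1\rangle\otimes U_2|\psi\rangle$. Define channels from $\mathcal{Q}\otimes\mathcal{H}$ to $\mathcal{Q}\otimes\mathcal{B}$ by $C_1(\rho)=\operatorname{tr}_{\mathcal{K}}V(\rho\otimes|0\rangle\langle0|)V^*$ and $C_2(\rho)=\operatorname{tr}_{\mathcal{K}}Z_{\mathcal{Q}}V(\rho\otimes|0\rangle\langle0|)V^*Z_{\mathcal{Q}}$, where $Z_{\mathcal{Q}}=Z\otimes\mathbb{1}_{\mathcal{K}}\otimes\mathbb{1}_{\mathcal{B}}$ with $Z$ the Pauli $Z$ operator. Then $\tfrac12\|C_1-C_2\|_\diamond=\max_{\rho,\sigma}F(Q_1(\rho),Q_2(\sigma))$, the maximum over density operators $\rho,\sigma$ on $\mathcal{H}$.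
   Context: All spaces are finite-dimensional complex Hilbert spaces. Diamond norm: $\|\Phi\|_\diamond=\max_{X\neq0}\|(\Phi\otimes\mathrm{id}_{L(\mathcal{X})})(X)\|_1/\|X\|_1$ for $\Phi:L(\mathcal{X})\to L(\mathcal{Y})$, $\|\cdot\|_1$ the trace norm. Fidelity: $F(\rho,\sigma)=\operatorname{tr}\sqrt{\sqrt\rho\,\sigma\sqrt\rho}$. *)

theory Defs
  imports Complex_Main "Jordan_Normal_Form.Matrix"
begin

text \<open>Finite-dimensional Hilbert spaces are modelled as C^d with standard basis
  |0>,...,|d-1>; operators are complex matrices (Jordan_Normal_Form).
  Tensor product convention: the basis vector |i> (x) |j> of C^m (x) C^n has index i*n + j.\<close>

definition adj :: "complex mat \<Rightarrow> complex mat" where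
  "adj A = mat (dim_col A) (dim_row A) (\<lambda>(i,j). cnj (A $$ (j,i)))"

definition mtrace :: "complex mat \<Rightarrow> complex" where
  "mtrace A = (\<Sum>i<dim_row A. A $$ (i,i))"

definition unitary_mat :: "nat \<Rightarrow> nat \<Rightarrow> complex mat \<Rightarrow> bool" where
  "unitary_mat n m U \<longleftrightarrow> U \<in> carrier_mat n m \<and> adj U * U = 1\<^sub>m m \<and> U * adj U = 1\<^sub>m n"

definition psd :: "nat \<Rightarrow> complex mat \<Rightarrow> bool" where
  "psd n A \<longleftrightarrow> A \<in> carrier_mat n n \<and> adj A = A \<and>
     (\<forall>v :: nat \<Rightarrow> complex. 0 \<le> Re (\<Sum>i<n. \<Sum>j<n. cnj (v i) * A $$ (i,j) * v j))"

definition density :: "nat \<Rightarrow> complex mat \<Rightarrow> bool" where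
  "density n \<rho> \<longleftrightarrow> psd n \<rho> \<and> mtrace \<rho> = 1"

definition msqrt :: "complex mat \<Rightarrow> complex mat" where
  "msqrt A = (THE B. psd (dim_row A) B \<and> B * B = A)"

definition trace_norm :: "complex mat \<Rightarrow> real" where
  "trace_norm A = Re (mtrace (msqrt (adj A * A)))"

definition fidelity :: "complex mat \<Rightarrow> complex mat \<Rightarrow> real" where
  "fidelity \<rho> \<sigma> = Re (mtrace (msqrt (msqrt \<rho> * \<sigma> * msqrt \<rho>)))"

definition kron :: "complex mat \<Rightarrow> complex mat \<Rightarrow> complex mat" where
  "kron A B = mat (dim_row A * dim_row B) (dim_col A * dim_col B)
     (\<lambda>(i,j). A $$ (i div dim_row B, j div dim_col B) * B $$ (i mod dim_row B, j mod dim_col B))"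

definition ketbra :: "nat \<Rightarrow> nat \<Rightarrow> nat \<Rightarrow> complex mat" where
  "ketbra d a b = mat d d (\<lambda>(i,j). if i = a \<and> j = b then 1 else 0)"

definition ptrace2 :: "nat \<Rightarrow> nat \<Rightarrow> complex mat \<Rightarrow> complex mat" where
  "ptrace2 d1 d2 M = mat d1 d1 (\<lambda>(i,j). \<Sum>k<d2. M $$ (i*d2 + k, j*d2 + k))"

definition ptrace_mid :: "nat \<Rightarrow> nat \<Rightarrow> nat \<Rightarrow> complex mat \<Rightarrow> complex mat" where
  "ptrace_mid d1 d2 d3 M = mat (d1*d3) (d1*d3) (\<lambda>(i,j).
     \<Sum>k<d2. M $$ ((i div d3)*(d2*d3) + k*d3 + i mod d3, (j div d3)*(d2*d3) + k*d3 + j mod d3))"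

text \<open>(Phi (x) id_{L(C^dX)})(X) for X an operator on C^dX (x) C^dX, Phi : L(C^dX) -> L(C^dY)
  (extended by linearity: X = sum_{a,b} X_ab (x) |a><b|).\<close>
definition tensor_id :: "nat \<Rightarrow> nat \<Rightarrow> (complex mat \<Rightarrow> complex mat) \<Rightarrow> complex mat \<Rightarrow> complex mat" where
  "tensor_id dX dY \<Phi> X = mat (dY*dX) (dY*dX) (\<lambda>(i,j).
     (\<Phi> (mat dX dX (\<lambda>(p,q). X $$ (p*dX + i mod dX, q*dX + j mod dX)))) $$ (i div dX, j div dX))"

definition diamond_norm :: "nat \<Rightarrow> nat \<Rightarrow> (complex mat \<Rightarrow> complex mat) \<Rightarrow> real" where
  "diamond_norm dX dY \<Phi> = Sup {trace_norm (tensor_id dX dY \<Phi> X) / trace_norm X | X.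
     X \<in> carrier_mat (dX*dX) (dX*dX) \<and> X \<noteq> 0\<^sub>m (dX*dX) (dX*dX)}"

definition pauliZ :: "complex mat" where
  "pauliZ = mat 2 2 (\<lambda>(i,j). if i = j then (if i = 0 then 1 else -1) else 0)"

end

theory Submission
  imports
    "HOL-Analysis.Function_Topology" "HOL-Analysis.Topology_Euclidean_Space"
    "Jordan_Normal_Form.Spectral_Radius" "Jordan_Normal_Form.Schur_Decomposition" Defs
begin

text \<open>Conjugation by \<open>Z\<close> on the control qubit flips the sign of the off-diagonal blocks, so \<open>C1 - C2\<close> is
  twice the off-diagonal part: it sends the block \<open>Y\<close> at position \<open>(0,1)\<close> to
  \<open>\<Psi> Y = tr_K (A1 Y A2*)\<close>, with \<open>A_i = U_i (1 \<otimes> |0>)\<close>, and symmetrically for \<open>(1,0)\<close>.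
  For vectors \<open>x\<close>, \<open>y\<close> purifying \<open>\<rho>\<close>, \<open>\<sigma>\<close>, the vectors \<open>A1 x\<close>, \<open>A2 y\<close> reshaped to matrices
  \<open>G1\<close>, \<open>G2\<close> with rows indexed by \<open>K\<close> satisfy \<open>Q1 \<rho> = G1 G1*\<close> and \<open>Q2 \<sigma> = G2 G2*\<close>, while
  \<open>\<Psi> (x y*)\<close> is \<open>transpose G1\<close> times the conjugate of \<open>G2\<close>, whose trace norm is the fidelity
  \<open>F (G1 G1*, G2 G2*)\<close>.  Hence the input \<open>(|0> x) (|1> y)*\<close> attains \<open>2 F\<close>.  Conversely every input
  is a sum of rank-one operators \<open>x y*\<close> with \<open>\<Sum> |x| |y|\<close> its trace norm, and Cauchy-Schwarz
  \<open>|x0| |y1| + |x1| |y0| \<le> |x| |y|\<close> shows that using both off-diagonal blocks gains nothing.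
  Writing the trace norm as a maximum over contractions turns the supremum over \<open>x\<close>, \<open>y\<close> into the
  maximum of a continuous function on a compact set.\<close>

section \<open>Diagonalization of Hermitian matrices\<close>

lemma adj_dim [simp]: "dim_row (adj A) = dim_col A" "dim_col (adj A) = dim_row A"
  by (simp_all add: adj_def)

lemma adj_carrier [simp, intro]: "A \<in> carrier_mat n m \<Longrightarrow> adj A \<in> carrier_mat m n"
  by (rule carrier_matI) auto

lemma adj_index [simp]: "i < dim_col A \<Longrightarrow> j < dim_row A \<Longrightarrow> adj A $$ (i,j) = cnj (A $$ (j,i))"
  by (simp add: adj_def)

lemma adj_adj [simp]: "adj (adj A) = A"
  by (rule eq_matI) auto

lemma index_mult_mat_sum:
  assumes "A \<in> carrier_mat n m" "B \<in> carrier_mat m k" "i < n" "j < k"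
  shows "(A * B) $$ (i,j) = (\<Sum>l<m. A $$ (i,l) * B $$ (l,j))"
  using assms by (auto simp: scalar_prod_def atLeast0LessThan intro!: sum.cong)

lemma adj_mult:
  assumes "A \<in> carrier_mat n m" "B \<in> carrier_mat m k"
  shows "adj (A * B) = adj B * adj A"
proof (rule eq_matI)
  fix i j assume "i < dim_row (adj B * adj A)" "j < dim_col (adj B * adj A)"
  then have ij: "i < k" "j < n" using assms by auto
  have "adj (A * B) $$ (i,j) = cnj ((A * B) $$ (j,i))" using assms ij by auto
  also have "\<dots> = (adj B * adj A) $$ (i,j)"
    using assms ij index_mult_mat_sum[of A n m B k j i] index_mult_mat_sum[of "adj B" k m "adj A" n i j]
    by (auto simp: mult.commute intro!: sum.cong)
  finally show "adj (A * B) $$ (i,j) = (adj B * adj A) $$ (i,j)" .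
qed (use assms in auto)

lemma index_mult_diag_adj:
  assumes "P \<in> carrier_mat n k" "Q \<in> carrier_mat m k" "i < n" "j < m"
  shows "(P * mat_diag k f * adj Q) $$ (i,j) = (\<Sum>l<k. P $$ (i,l) * f l * cnj (Q $$ (j,l)))"
proof -
  have "P * mat_diag k f = mat n k (\<lambda>(i,j). P $$ (i,j) * f j)"
    using assms(1) by (rule mat_diag_mult_right)
  then show ?thesis
    using assms by (subst index_mult_mat_sum[of _ n k _ m]) (auto intro!: sum.cong)
qed

text \<open>A left inverse of a square matrix is also a right inverse, so orthonormal columns
  already make the matrix unitary.\<close>

lemma unitary_matI:
  assumes "U \<in> carrier_mat n n" "adj U * U = 1\<^sub>m n"
  shows "unitary_mat n n U"
  using assms mat_mult_left_right_inverse[of "adj U" n U] by (auto simp: unitary_mat_def)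

text \<open>Basis completion followed by Gram-Schmidt keeps the first vector in place, and
  normalization only rescales it. The scalar \<open>c\<close> stays unspecified because an
  eigenvector may be rescaled freely.\<close>

lemma unitary_with_first_column:
  assumes v: "v \<in> carrier_vec n" "v \<noteq> 0\<^sub>v n"
  shows "\<exists>W c. unitary_mat n n W \<and> (\<forall>i<n. W $$ (i,0) = c * v $ i)"
proof -
  interpret cof_vec_space n "TYPE(complex)" .
  define b where "b = basis_completion v"
  define ws where "ws = gram_schmidt n b"
  have b: "distinct b" "\<not> lin_dep (set b)" "set b \<subseteq> carrier_vec n" "hd b = v" "length b = n"
    using basis_completion[OF v] by (auto simp: b_def)
  have n0: "n > 0" using v by (cases n) auto
  then obtain vs where bv: "b = v # vs" using b by (cases b) auto
  have ws: "set ws \<subseteq> carrier_vec n" "corthogonal ws" "length ws = n"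
    using gram_schmidt_result[OF b(3,1,2) refl] b(5) by (auto simp: ws_def)
  have "hd ws = v" using gram_schmidt_hd[OF v(1), of vs] by (simp add: ws_def bv)
  then have ws0: "ws ! 0 = v" using ws(3) n0 by (cases ws) auto
  have wsc: "ws ! j \<in> carrier_vec n" if "j < n" for j using ws that by auto
  define N where "N j = (\<Sum>i<n. (cmod (ws ! j $ i))\<^sup>2)" for j
  have cs: "ws ! k \<bullet>c ws ! j = (\<Sum>i<n. ws ! k $ i * cnj (ws ! j $ i))" if "j < n" "k < n" for j k
    using wsc[OF that(1)] wsc[OF that(2)]
    by (auto simp: scalar_prod_def atLeast0LessThan intro!: sum.cong)
  \<comment> \<open>\<open>corthogonal\<close> also excludes null vectors: the case
    \<open>k = j\<close> of this equivalence gives \<open>Npos\<close>.\<close>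
  have orth: "(\<Sum>i<n. ws ! k $ i * cnj (ws ! j $ i)) = 0 \<longleftrightarrow> k \<noteq> j" if "j < n" "k < n" for j k
    using corthogonalD[OF ws(2), of k j] that ws(3) cs[OF that] by simp
  have Ns: "(\<Sum>i<n. ws ! j $ i * cnj (ws ! j $ i)) = complex_of_real (N j)" for j
    by (simp add: N_def complex_mult_cnj cmod_power2)
  have Npos: "N j > 0" if "j < n" for j
  proof -
    have "N j \<noteq> 0" using orth[OF that that] Ns[of j] by auto
    moreover have "N j \<ge> 0" by (simp add: N_def sum_nonneg)
    ultimately show ?thesis by simp
  qed
  define W where "W = mat n n (\<lambda>(i,j). ws ! j $ i / complex_of_real (sqrt (N j)))"
  have W: "W \<in> carrier_mat n n" by (simp add: W_def)
  have "adj W * W = 1\<^sub>m n"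
  proof (rule eq_matI)
    fix j k assume "j < dim_row (1\<^sub>m n :: complex mat)" "k < dim_col (1\<^sub>m n :: complex mat)"
    then have jk: "j < n" "k < n" by auto
    have "(adj W * W) $$ (j,k) = (\<Sum>i<n. cnj (W $$ (i,j)) * W $$ (i,k))"
      using W jk by (subst index_mult_mat_sum[of _ n n _ n]) auto
    also have "\<dots> = (\<Sum>i<n. ws ! k $ i * cnj (ws ! j $ i)) / complex_of_real (sqrt (N j) * sqrt (N k))"
      using jk by (auto simp: W_def sum_divide_distrib field_simps intro!: sum.cong)
    also have "\<dots> = 1\<^sub>m n $$ (j,k)"
    proof (cases "j = k")
      case True
      then show ?thesis using jk Ns[of j] Npos[OF jk(1)] by (simp del: of_real_mult)
    next
      case False
      then show ?thesis using jk orth[OF jk] by simp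
    qed
    finally show "(adj W * W) $$ (j,k) = 1\<^sub>m n $$ (j,k)" .
  qed (use W in auto)
  then have "unitary_mat n n W" using W by (rule unitary_matI[rotated])
  moreover have "\<forall>i<n. W $$ (i,0) = (1 / complex_of_real (sqrt (N 0))) * v $ i"
    using n0 ws0 by (simp add: W_def)
  ultimately show ?thesis by blast
qed

lemma unitary_mat_mult:
  assumes "unitary_mat n n U" "unitary_mat n n V"
  shows "unitary_mat n n (U * V)"
proof (rule unitary_matI)
  have c: "U \<in> carrier_mat n n" "V \<in> carrier_mat n n" and
    u: "adj U * U = 1\<^sub>m n" "adj V * V = 1\<^sub>m n"
    using assms by (auto simp: unitary_mat_def)
  show "U * V \<in> carrier_mat n n" using c by auto
  have "adj (U * V) * (U * V) = adj V * (adj U * U) * V"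
    using c by (simp add: adj_mult[of U n n V n] assoc_mult_mat[of _ n n _ n _ n] mult_carrier_mat[of _ n n _ n])
  also have "\<dots> = 1\<^sub>m n" using u c by simp
  finally show "adj (U * V) * (U * V) = 1\<^sub>m n" .
qed

lemma conj_conj:
  assumes "U \<in> carrier_mat n n" "V \<in> carrier_mat n n" "X \<in> carrier_mat n n"
  shows "U * (V * X * adj V) * adj U = U * V * X * adj (U * V)"
proof -
  have c: "V * X \<in> carrier_mat n n" "V * X * adj V \<in> carrier_mat n n" "U * V \<in> carrier_mat n n"
    "U * V * X \<in> carrier_mat n n"
    using assms by auto
  have "U * (V * X * adj V) = U * V * X * adj V"
    using assms c assoc_mult_mat[of U n n V n X n] assoc_mult_mat[of U n n "V * X" n "adj V" n] by simp
  then show ?thesis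
    using assms c assoc_mult_mat[of "U * V * X" n n "adj V" n "adj U" n] by (simp add: adj_mult[of U n n V n])
qed

text \<open>Deflation: in an orthonormal basis that starts with an eigenvector, a Hermitian matrix
  splits into a real scalar and a smaller Hermitian block \<open>B\<close>, to which the induction
  hypothesis applies.\<close>

lemma hermitian_diagonalization:
  assumes "A \<in> carrier_mat n n" "adj A = A"
  shows "\<exists>P (d :: nat \<Rightarrow> real). unitary_mat n n P \<and> A = P * mat_diag n (\<lambda>i. complex_of_real (d i)) * adj P"
  using assms
proof (induction n arbitrary: A)
  case 0
  have "unitary_mat 0 0 (1\<^sub>m 0)" by (auto simp: unitary_mat_def intro!: eq_matI)
  moreover have "A = 1\<^sub>m 0 * mat_diag 0 (\<lambda>i. complex_of_real (0::real)) * adj (1\<^sub>m 0)"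
    using 0 by (intro eq_matI) auto
  ultimately show ?case by (intro exI[of _ "1\<^sub>m 0"] exI[of _ "\<lambda>_. 0"]) simp
next
  case (Suc n A)
  let ?n = "Suc n"
  note A = Suc.prems(1)
  obtain e where "eigenvalue A e"
    using spectrum_non_empty[OF A] unfolding spectrum_def by auto
  then obtain v where v: "v \<in> carrier_vec ?n" "v \<noteq> 0\<^sub>v ?n" and ev: "A *\<^sub>v v = e \<cdot>\<^sub>v v"
    using A unfolding eigenvalue_def eigenvector_def by auto
  obtain W c where W: "unitary_mat ?n ?n W" and W0: "\<And>i. i < ?n \<Longrightarrow> W $$ (i,0) = c * v $ i"
    using unitary_with_first_column[OF v] by blast
  have Wc: "W \<in> carrier_mat ?n ?n" and W1: "adj W * W = 1\<^sub>m ?n" and W2: "W * adj W = 1\<^sub>m ?n"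
    using W by (auto simp: unitary_mat_def)
  define A' where "A' = adj W * A * W"
  have A'c: "A' \<in> carrier_mat ?n ?n" using A Wc by (auto simp: A'_def)
  have A'h: "adj A' = A'"
    using A Wc Suc.prems(2) unfolding A'_def
    by (simp add: adj_mult[of _ ?n ?n _ ?n] assoc_mult_mat[of _ ?n ?n _ ?n _ ?n])
  have AW0: "(A * W) $$ (i,0) = e * W $$ (i,0)" if "i < ?n" for i
  proof -
    have "(A * W) $$ (i,0) = (\<Sum>k<?n. A $$ (i,k) * (c * v $ k))"
      using A Wc that W0 by (subst index_mult_mat_sum[of _ ?n ?n _ ?n]) (auto intro!: sum.cong)
    also have "\<dots> = c * (A *\<^sub>v v) $ i"
      using A v that by (auto simp: scalar_prod_def atLeast0LessThan sum_distrib_left mult_ac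
          simp del: sum.lessThan_Suc intro!: sum.cong)
    finally show ?thesis using ev W0[OF that] v that by simp
  qed
  have A'0: "A' $$ (i,0) = (if i = 0 then e else 0)" if "i < ?n" for i
  proof -
    have "A' = adj W * (A * W)" using A Wc by (simp add: A'_def assoc_mult_mat[of _ ?n ?n _ ?n _ ?n])
    then have "A' $$ (i,0) = (\<Sum>k<?n. adj W $$ (i,k) * (A * W) $$ (k,0))"
      using A Wc that index_mult_mat_sum[of "adj W" ?n ?n "A * W" ?n i 0] by auto
    also have "\<dots> = e * (\<Sum>k<?n. adj W $$ (i,k) * W $$ (k,0))"
      using AW0 by (auto simp: sum_distrib_left mult_ac simp del: sum.lessThan_Suc intro!: sum.cong)
    also have "(\<Sum>k<?n. adj W $$ (i,k) * W $$ (k,0)) = (adj W * W) $$ (i,0)"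
      using Wc that index_mult_mat_sum[of "adj W" ?n ?n W ?n i 0] by auto
    finally show ?thesis using W1 that by simp
  qed
  \<comment> \<open>Hermiticity carries the zeros of the first column over to the first row, which
    splits off the block \<open>B\<close>.\<close>
  have A'0': "A' $$ (0,i) = (if i = 0 then e else 0)" if "i < ?n" for i
  proof (cases "i = 0")
    case True
    then show ?thesis using A'0[of 0] by simp
  next
    case False
    have "A' $$ (0,i) = adj A' $$ (0,i)" using A'h by simp
    also have "\<dots> = cnj (A' $$ (i,0))" using A'c that by simp
    finally show ?thesis using A'0[OF that] False by simp
  qed
  have e_real: "complex_of_real (Re e) = e"
  proof -
    have "A' $$ (0,0) = adj A' $$ (0,0)" using A'h by simp
    also have "\<dots> = cnj (A' $$ (0,0))" using A'c by simp
    finally have "e = cnj e" using A'0[of 0] by simp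
    then show ?thesis by (simp add: complex_eq_iff)
  qed
  define B where "B = mat n n (\<lambda>(i,j). A' $$ (Suc i, Suc j))"
  have "adj B = B"
  proof (rule eq_matI)
    fix i j assume "i < dim_row B" "j < dim_col B"
    then have ij: "i < n" "j < n" by (auto simp: B_def)
    have "A' $$ (Suc i, Suc j) = adj A' $$ (Suc i, Suc j)" using A'h by simp
    also have "\<dots> = cnj (A' $$ (Suc j, Suc i))" using A'c ij by simp
    finally show "adj B $$ (i,j) = B $$ (i,j)" using ij by (simp add: B_def)
  qed (auto simp: B_def)
  then obtain P d where P: "unitary_mat n n P"
    and Bd: "B = P * mat_diag n (\<lambda>i. complex_of_real (d i)) * adj P"
    using Suc.IH[of B] by (auto simp: B_def)
  have Pc: "P \<in> carrier_mat n n" and P1: "adj P * P = 1\<^sub>m n" using P by (auto simp: unitary_mat_def)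
  \<comment> \<open>\<open>P'\<close> is the direct sum of the scalar 1 and \<open>P\<close>, and
    \<open>d'\<close> puts the eigenvalue \<open>e\<close> in front of those of
    \<open>B\<close>.\<close>
  define P' where "P' = mat ?n ?n (\<lambda>(i,j). case i of 0 \<Rightarrow> (if j = 0 then 1 else 0)
      | Suc i \<Rightarrow> (case j of 0 \<Rightarrow> 0 | Suc j \<Rightarrow> P $$ (i,j)))"
  define d' where "d' = case_nat (Re e) d"
  have P'c: "P' \<in> carrier_mat ?n ?n" by (simp add: P'_def)
  have P'u: "unitary_mat ?n ?n P'"
  proof (rule unitary_matI[OF P'c], rule eq_matI)
    fix i j assume "i < dim_row (1\<^sub>m ?n :: complex mat)" "j < dim_col (1\<^sub>m ?n :: complex mat)"
    then have ij: "i < ?n" "j < ?n" by auto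
    have "(adj P' * P') $$ (i,j) = (\<Sum>k<?n. cnj (P' $$ (k,i)) * P' $$ (k,j))"
      using P'c ij by (subst index_mult_mat_sum[of _ ?n ?n _ ?n]) auto
    also have "\<dots> = cnj (P' $$ (0,i)) * P' $$ (0,j) + (\<Sum>k<n. cnj (P' $$ (Suc k,i)) * P' $$ (Suc k,j))"
      by (rule sum.lessThan_Suc_shift)
    also have "\<dots> = 1\<^sub>m ?n $$ (i,j)"
    proof (cases i)
      case 0
      then show ?thesis using ij by (auto simp: P'_def)
    next
      case (Suc i')
      show ?thesis
      proof (cases j)
        case 0
        then show ?thesis using ij Suc by (auto simp: P'_def)
      next
        case (Suc j')
        have "(\<Sum>k<n. cnj (P $$ (k,i')) * P $$ (k,j')) = (adj P * P) $$ (i',j')"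
          using ij Suc \<open>i = Suc i'\<close> Pc by (subst index_mult_mat_sum[of _ n n _ n]) auto
        then show ?thesis using P1 ij Suc \<open>i = Suc i'\<close> by (simp add: P'_def)
      qed
    qed
    finally show "(adj P' * P') $$ (i,j) = 1\<^sub>m ?n $$ (i,j)" .
  qed (use P'c in auto)
  let ?D = "mat_diag ?n (\<lambda>i. complex_of_real (d' i))"
  have A'd: "A' = P' * ?D * adj P'"
  proof (rule eq_matI)
    fix i j assume "i < dim_row (P' * ?D * adj P')" "j < dim_col (P' * ?D * adj P')"
    then have ij: "i < ?n" "j < ?n" using P'c by auto
    have "(P' * ?D * adj P') $$ (i,j) = (\<Sum>k<?n. P' $$ (i,k) * complex_of_real (d' k) * cnj (P' $$ (j,k)))"
      using index_mult_diag_adj[OF P'c P'c ij] by simp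
    also have "\<dots> = P' $$ (i,0) * complex_of_real (Re e) * cnj (P' $$ (j,0))
       + (\<Sum>k<n. P' $$ (i,Suc k) * complex_of_real (d k) * cnj (P' $$ (j,Suc k)))"
      by (subst sum.lessThan_Suc_shift) (simp add: d'_def)
    also have "\<dots> = A' $$ (i,j)"
    proof (cases i)
      case 0
      then show ?thesis using ij A'0'[of j] e_real by (cases j) (auto simp: P'_def)
    next
      case (Suc i')
      show ?thesis
      proof (cases j)
        case 0
        then show ?thesis using ij Suc A'0[of i] by (auto simp: P'_def)
      next
        case (Suc j')
        then have ij': "i' < n" "j' < n" using ij \<open>i = Suc i'\<close> by auto
        have "(\<Sum>k<n. P $$ (i',k) * complex_of_real (d k) * cnj (P $$ (j',k))) = B $$ (i',j')"
          using index_mult_diag_adj[OF Pc Pc ij'] Bd by simp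
        then show ?thesis using ij' Suc \<open>i = Suc i'\<close> by (simp add: P'_def B_def)
      qed
    qed
    finally show "A' $$ (i,j) = (P' * ?D * adj P') $$ (i,j)" by simp
  qed (use P'c A'c in auto)
  have Dc: "?D \<in> carrier_mat ?n ?n" by simp
  have "A = (W * adj W) * A * (W * adj W)" using W2 A by simp
  also have "\<dots> = W * A' * adj W"
    using A Wc unfolding A'_def
    by (simp add: assoc_mult_mat[of _ ?n ?n _ ?n _ ?n] mult_carrier_mat[of _ ?n ?n _ ?n])
  also have "\<dots> = (W * P') * ?D * adj (W * P')"
    unfolding A'd using Wc P'c Dc by (rule conj_conj)
  finally show ?case using unitary_mat_mult[OF W P'u] by blast
qed

section \<open>Positive square roots\<close>

lemma mat_diag_dims [simp]: "dim_row (mat_diag n f) = n" "dim_col (mat_diag n f) = n"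
  by (simp_all add: mat_diag_def)

lemma psd_carrier: "psd n A \<Longrightarrow> A \<in> carrier_mat n n"
  by (simp add: psd_def)

text \<open>The quadratic form at \<open>v\<close> is the squared norm of \<open>adj G\<close>
  applied to \<open>v\<close>.\<close>

lemma psd_mult_adj:
  assumes "G \<in> carrier_mat n m"
  shows "psd n (G * adj G)"
  unfolding psd_def
proof (intro conjI allI)
  show "G * adj G \<in> carrier_mat n n" using assms by auto
  show "adj (G * adj G) = G * adj G" using assms by (simp add: adj_mult[of _ n m _ n])
  fix v :: "nat \<Rightarrow> complex"
  have "(\<Sum>i<n. \<Sum>j<n. cnj (v i) * (G * adj G) $$ (i,j) * v j)
      = (\<Sum>i<n. \<Sum>j<n. \<Sum>l<m. cnj (v i) * G $$ (i,l) * (cnj (G $$ (j,l)) * v j))"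
    using assms
    by (auto simp: index_mult_mat_sum[of _ n m _ n] sum_distrib_left sum_distrib_right mult_ac
        simp del: sum.lessThan_Suc index_mult_mat intro!: sum.cong)
  also have "\<dots> = (\<Sum>l<m. \<Sum>i<n. \<Sum>j<n. cnj (v i) * G $$ (i,l) * (cnj (G $$ (j,l)) * v j))"
    by (subst sum.swap[of _ "{..<m}"], subst sum.swap[of _ "{..<m}"]) (rule refl)
  also have "\<dots> = (\<Sum>l<m. (\<Sum>i<n. cnj (v i) * G $$ (i,l)) * cnj (\<Sum>j<n. cnj (v j) * G $$ (j,l)))"
    unfolding cnj_sum sum_product by (simp add: mult_ac)
  also have "Re \<dots> \<ge> 0"
    unfolding complex_norm_square[symmetric] by (simp add: sum_nonneg)
  finally show "0 \<le> Re (\<Sum>i<n. \<Sum>j<n. cnj (v i) * (G * adj G) $$ (i,j) * v j)" .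
qed

lemma psd_adj_mult: "M \<in> carrier_mat n m \<Longrightarrow> psd m (adj M * M)"
  using psd_mult_adj[of "adj M" m n] by simp

text \<open>Absorbing the square roots of the eigenvalues into the columns of \<open>P\<close>
  exhibits the matrix as \<open>G * adj G\<close>.\<close>

lemma psd_conj_diag:
  assumes P: "P \<in> carrier_mat n n" and d: "\<And>i. i < n \<Longrightarrow> d i \<ge> 0"
  shows "psd n (P * mat_diag n (\<lambda>i. complex_of_real (d i)) * adj P)"
proof -
  define G where "G = mat n n (\<lambda>(i,j). P $$ (i,j) * complex_of_real (sqrt (d j)))"
  have G: "G \<in> carrier_mat n n" by (simp add: G_def)
  have "P * mat_diag n (\<lambda>i. complex_of_real (d i)) * adj P = G * adj G"
  proof (rule eq_matI)
    fix i j assume "i < dim_row (G * adj G)" "j < dim_col (G * adj G)"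
    then have ij: "i < n" "j < n" by (auto simp: G_def)
    have "complex_of_real (sqrt (d l)) * complex_of_real (sqrt (d l)) = complex_of_real (d l)"
      if "l < n" for l
      using d[OF that] by (metis of_real_mult real_sqrt_mult_self abs_of_nonneg)
    then have "P $$ (i,l) * complex_of_real (d l) * cnj (P $$ (j,l)) = G $$ (i,l) * adj G $$ (l,j)"
      if "l < n" for l
      using that ij by (simp add: G_def mult_ac)
    then show "(P * mat_diag n (\<lambda>i. complex_of_real (d i)) * adj P) $$ (i,j) = (G * adj G) $$ (i,j)"
      using index_mult_diag_adj[OF P P ij] index_mult_mat_sum[OF G adj_carrier[OF G] ij]
      by simp
  qed (use P in \<open>auto simp: G_def\<close>)
  then show ?thesis using psd_mult_adj[OF G] by simp
qed

text \<open>Each eigenvalue is the value of the quadratic form at the corresponding column of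
  \<open>P\<close>, hence nonnegative.\<close>

lemma psd_diagonalization:
  assumes "psd n A"
  shows "\<exists>P (d :: nat \<Rightarrow> real). unitary_mat n n P \<and> (\<forall>i<n. d i \<ge> 0) \<and>
           A = P * mat_diag n (\<lambda>i. complex_of_real (d i)) * adj P"
proof -
  have A: "A \<in> carrier_mat n n" "adj A = A" using assms by (auto simp: psd_def)
  obtain P d where U: "unitary_mat n n P" and eq: "A = P * mat_diag n (\<lambda>i. complex_of_real (d i)) * adj P"
    using hermitian_diagonalization[OF A] by blast
  let ?D = "mat_diag n (\<lambda>i. complex_of_real (d i))"
  have P: "P \<in> carrier_mat n n" "adj P * P = 1\<^sub>m n" using U by (auto simp: unitary_mat_def)
  have "d k \<ge> 0" if k: "k < n" for k
  proof -
    have "adj P * (A * P) = (adj P * P) * ?D * (adj P * P)"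
      unfolding eq using P(1)
      by (simp add: assoc_mult_mat[of _ n n _ n _ n] mult_carrier_mat[of _ n n _ n])
    also have "\<dots> = ?D" using P(2) by simp
    finally have "complex_of_real (d k) = (adj P * (A * P)) $$ (k,k)"
      using k by (simp add: mat_diag_def)
    also have "\<dots> = (\<Sum>i<n. adj P $$ (k,i) * (A * P) $$ (i,k))"
      using P A k by (subst index_mult_mat_sum[of _ n n _ n]) auto
    also have "\<dots> = (\<Sum>i<n. \<Sum>j<n. cnj (P $$ (i,k)) * A $$ (i,j) * P $$ (j,k))"
      using P A k
      by (auto simp: index_mult_mat_sum[of _ n n _ n] sum_distrib_left mult_ac
          simp del: sum.lessThan_Suc index_mult_mat intro!: sum.cong)
    finally have "d k = Re (\<Sum>i<n. \<Sum>j<n. cnj (P $$ (i,k)) * A $$ (i,j) * P $$ (j,k))"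
      by (metis Re_complex_of_real)
    then show ?thesis
      using assms[unfolded psd_def, THEN conjunct2, THEN conjunct2, rule_format, of "\<lambda>i. P $$ (i,k)"] by simp
  qed
  then show ?thesis using U eq by blast
qed

lemma conj_diag_mult:
  assumes "unitary_mat n n P"
  shows "(P * mat_diag n f * adj P) * (P * mat_diag n g * adj P) = P * mat_diag n (\<lambda>i. f i * g i) * adj P"
proof -
  have P: "P \<in> carrier_mat n n" "adj P * P = 1\<^sub>m n" using assms by (auto simp: unitary_mat_def)
  have "(P * mat_diag n f * adj P) * (P * mat_diag n g * adj P)
      = P * (mat_diag n f * ((adj P * P) * (mat_diag n g * adj P)))"
    using P(1) by (simp add: assoc_mult_mat[of _ n n _ n _ n] mult_carrier_mat[of _ n n _ n])
  also have "\<dots> = P * ((mat_diag n f * mat_diag n g) * adj P)"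
    unfolding P(2) using P(1)
    by (simp add: assoc_mult_mat[of _ n n _ n _ n] mult_carrier_mat[of _ n n _ n]
        del: mat_diag_diag)
  finally show ?thesis
    using P(1) by (simp add: assoc_mult_mat[of _ n n _ n _ n] mult_carrier_mat[of _ n n _ n])
qed

text \<open>Writing \<open>B = P diag(b) P*\<close>, \<open>C = Q diag(c) Q*\<close> and \<open>W = P* Q\<close>, the equation \<open>B * B = C * C\<close>
  says \<open>b i ^ 2 * W i j = W i j * c j ^ 2\<close>, and nonnegativity removes the squares.\<close>

lemma psd_sqrt_unique:
  assumes "psd n B" "psd n C" "B * B = C * C"
  shows "B = C"
proof -
  obtain P b where U: "unitary_mat n n P" and b: "\<And>i. i < n \<Longrightarrow> b i \<ge> 0"
    and B: "B = P * mat_diag n (\<lambda>i. complex_of_real (b i)) * adj P"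
    using psd_diagonalization[OF assms(1)] by blast
  obtain Q c where V: "unitary_mat n n Q" and c: "\<And>i. i < n \<Longrightarrow> c i \<ge> 0"
    and C: "C = Q * mat_diag n (\<lambda>i. complex_of_real (c i)) * adj Q"
    using psd_diagonalization[OF assms(2)] by blast
  have P: "P \<in> carrier_mat n n" "adj P * P = 1\<^sub>m n" "P * adj P = 1\<^sub>m n"
    and Q: "Q \<in> carrier_mat n n" "adj Q * Q = 1\<^sub>m n" "Q * adj Q = 1\<^sub>m n"
    using U V by (auto simp: unitary_mat_def)
  define W where "W = adj P * Q"
  have W: "W \<in> carrier_mat n n" using P Q by (auto simp: W_def)
  note assoc = assoc_mult_mat[of _ n n _ n _ n] mult_carrier_mat[of _ n n _ n]
  \<comment> \<open>Used in both directions: with the squared eigenvalues to read off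
    \<open>B * B = C * C\<close> entrywise, and with the eigenvalues themselves to return to
    \<open>B = C\<close>.\<close>
  have flip: "mat_diag n f * W = W * mat_diag n g \<longleftrightarrow> P * mat_diag n f * adj P = Q * mat_diag n g * adj Q"
    (is "?l \<longleftrightarrow> ?r") for f g
  proof
    assume ?l
    have "P * mat_diag n f * adj P = P * (mat_diag n f * W) * adj Q"
      using P Q by (simp add: W_def assoc)
    also have "\<dots> = (P * adj P) * (Q * mat_diag n g * adj Q)"
      unfolding \<open>?l\<close> using P(1) Q(1) by (simp add: W_def assoc)
    finally show ?r using P Q by (simp add: mult_carrier_mat[of _ n n _ n])
  next
    assume ?r
    have "mat_diag n f * W = (adj P * P) * mat_diag n f * W"
      using P(2) by simp
    also have "\<dots> = adj P * (P * mat_diag n f * adj P) * Q"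
      using P(1) Q(1) by (simp add: W_def assoc)
    also have "\<dots> = W * mat_diag n g * (adj Q * Q)"
      unfolding \<open>?r\<close> using P(1) Q(1) by (simp add: W_def assoc)
    finally show ?l using Q W by (simp add: mult_carrier_mat[of _ n n _ n])
  qed
  have ent: "mat_diag n f * W = W * mat_diag n g \<longleftrightarrow> (\<forall>i<n. \<forall>j<n. f i * W $$ (i,j) = W $$ (i,j) * g j)" for f g
    unfolding mat_diag_mult_left[OF W, of f] mat_diag_mult_right[OF W, of g] by (auto simp: mat_eq_iff)
  have "mat_diag n (\<lambda>i. complex_of_real (b i) * complex_of_real (b i)) * W
      = W * mat_diag n (\<lambda>i. complex_of_real (c i) * complex_of_real (c i))"
    using assms(3) unfolding flip B C conj_diag_mult[OF U] conj_diag_mult[OF V] .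
  then have sq: "complex_of_real (b i * b i) * W $$ (i,j) = W $$ (i,j) * complex_of_real (c j * c j)"
    if "i < n" "j < n" for i j
    using that unfolding ent by simp
  have "complex_of_real (b i) * W $$ (i,j) = W $$ (i,j) * complex_of_real (c j)" if ij: "i < n" "j < n" for i j
  proof (cases "W $$ (i,j) = 0")
    case False
    then have "b i * b i = c j * c j"
      using sq[OF ij] by (metis mult.commute mult_cancel_right of_real_eq_iff)
    then have "b i = c j" using b[OF ij(1)] c[OF ij(2)] by (metis real_sqrt_mult_self abs_of_nonneg real_sqrt_abs2)
    then show ?thesis by simp
  qed simp
  then show ?thesis unfolding B C using ent flip by blast
qed

text \<open>Uniqueness of the positive root resolves the definite description in
  \<open>msqrt\<close>.\<close>

lemma msqrt_eqI:
  assumes "psd n B" "B * B = A"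
  shows "msqrt A = B"
proof -
  have "dim_row A = n" using psd_carrier[OF assms(1)] assms(2) by auto
  then show ?thesis
    unfolding msqrt_def using assms by (intro the_equality) (auto intro: psd_sqrt_unique)
qed

lemma psd_sqrt_conj_diag:
  assumes "unitary_mat n n P" "\<And>i. i < n \<Longrightarrow> d i \<ge> 0"
  defines "B \<equiv> P * mat_diag n (\<lambda>i. complex_of_real (sqrt (d i))) * adj P"
  shows "psd n B" "B * B = P * mat_diag n (\<lambda>i. complex_of_real (d i)) * adj P"
proof -
  have P: "P \<in> carrier_mat n n" using assms by (auto simp: unitary_mat_def)
  show "psd n B" unfolding B_def using assms(2) by (intro psd_conj_diag[OF P]) simp
  have "mat_diag n (\<lambda>i. complex_of_real (sqrt (d i)) * complex_of_real (sqrt (d i))) =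
      mat_diag n (\<lambda>i. complex_of_real (d i))"
    using assms(2) by (auto simp: mat_diag_def simp flip: of_real_mult intro!: eq_matI)
  then show "B * B = P * mat_diag n (\<lambda>i. complex_of_real (d i)) * adj P"
    unfolding B_def conj_diag_mult[OF assms(1)] by simp
qed

lemma msqrt_conj_diag:
  assumes "unitary_mat n n P" "\<And>i. i < n \<Longrightarrow> d i \<ge> 0"
  shows "msqrt (P * mat_diag n (\<lambda>i. complex_of_real (d i)) * adj P)
       = P * mat_diag n (\<lambda>i. complex_of_real (sqrt (d i))) * adj P"
  using psd_sqrt_conj_diag[OF assms(1), of d] assms(2) by (intro msqrt_eqI[of n]) simp_all

lemma psd_msqrt:
  assumes "psd n A"
  shows "psd n (msqrt A)" "msqrt A * msqrt A = A"
proof -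
  obtain P d where U: "unitary_mat n n P" and d: "\<And>i. i < n \<Longrightarrow> d i \<ge> 0"
    and A: "A = P * mat_diag n (\<lambda>i. complex_of_real (d i)) * adj P"
    using psd_diagonalization[OF assms] by blast
  show "psd n (msqrt A)" "msqrt A * msqrt A = A"
    unfolding A using msqrt_conj_diag[OF U, of d] psd_sqrt_conj_diag[OF U, of d] d by simp_all
qed

section \<open>The trace norm as a maximum over contractions\<close>

text \<open>Vectors are plain functions whose values from \<open>n\<close> on are ignored, so that
  sets of vectors live in a function space with its product topology.\<close>

definition vnorm :: "nat \<Rightarrow> (nat \<Rightarrow> complex) \<Rightarrow> real" where
  "vnorm n v = L2_set (\<lambda>i. cmod (v i)) {..<n}"

lemma vnorm_nonneg [simp]: "vnorm n v \<ge> 0"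
  by (simp add: vnorm_def L2_set_nonneg)

lemma vnorm_sq: "(vnorm n v)\<^sup>2 = (\<Sum>i<n. (cmod (v i))\<^sup>2)"
  by (simp add: vnorm_def L2_set_def sum_nonneg)

lemma of_real_vnorm_sq: "complex_of_real ((vnorm n v)\<^sup>2) = (\<Sum>i<n. cnj (v i) * v i)"
  unfolding vnorm_sq of_real_sum
  by (intro sum.cong refl) (metis complex_norm_square mult.commute of_real_power)

lemma vnorm_cnj [simp]: "vnorm n (\<lambda>i. cnj (v i)) = vnorm n v"
  by (simp add: vnorm_def)

lemma cmod_sum_mult_le_vnorm: "cmod (\<Sum>i<n. a i * b i) \<le> vnorm n a * vnorm n b"
proof -
  have "cmod (\<Sum>i<n. a i * b i) \<le> (\<Sum>i<n. \<bar>cmod (a i)\<bar> * \<bar>cmod (b i)\<bar>)"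
    by (rule order.trans[OF norm_sum]) (simp add: norm_mult)
  also have "\<dots> \<le> vnorm n a * vnorm n b"
    unfolding vnorm_def by (rule L2_set_mult_ineq)
  finally show ?thesis .
qed

text \<open>Operator norm at most 1, phrased through the sesquilinear form: each pair of test
  vectors contributes one closed condition on \<open>W\<close>, which suits the compactness
  argument.\<close>

definition contraction :: "nat \<Rightarrow> nat \<Rightarrow> (nat \<Rightarrow> nat \<Rightarrow> complex) \<Rightarrow> bool" where
  "contraction n m W \<longleftrightarrow>
     (\<forall>a b. cmod (\<Sum>i<n. \<Sum>j<m. cnj (a i) * W i j * b j) \<le> vnorm n a * vnorm m b)"

text \<open>The Hilbert-Schmidt inner product, that is the trace of \<open>adj W * M\<close>,
  antilinear in \<open>W\<close>.\<close>

definition hs_inner :: "nat \<Rightarrow> nat \<Rightarrow> (nat \<Rightarrow> nat \<Rightarrow> complex) \<Rightarrow> (nat \<Rightarrow> nat \<Rightarrow> complex) \<Rightarrow> complex" where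
  "hs_inner n m W M = (\<Sum>i<n. \<Sum>j<m. cnj (W i j) * M i j)"

lemma mtrace_conj_diag:
  assumes "unitary_mat n n P"
  shows "mtrace (P * mat_diag n f * adj P) = (\<Sum>k<n. f k)"
proof -
  have P: "P \<in> carrier_mat n n" "adj P * P = 1\<^sub>m n" using assms by (auto simp: unitary_mat_def)
  have "mtrace (P * mat_diag n f * adj P) = (\<Sum>i<n. \<Sum>k<n. P $$ (i,k) * f k * cnj (P $$ (i,k)))"
    using P(1) index_mult_diag_adj[OF P(1) P(1)] by (simp add: mtrace_def)
  also have "\<dots> = (\<Sum>k<n. f k * (\<Sum>i<n. cnj (P $$ (i,k)) * P $$ (i,k)))"
    by (subst sum.swap) (simp add: sum_distrib_left mult_ac)
  also have "\<dots> = (\<Sum>k<n. f k * (adj P * P) $$ (k,k))"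
    using P(1) by (intro sum.cong refl, subst index_mult_mat_sum[of _ n n _ n]) auto
  finally show ?thesis using P(2) by simp
qed

text \<open>If \<open>P\<close> diagonalizes \<open>adj M * M\<close>, its columns are right
  singular vectors of \<open>M\<close>: the columns of \<open>M * P\<close> are orthogonal and their
  lengths are the singular values.\<close>

lemma trace_norm_singular_vectors:
  assumes M: "M \<in> carrier_mat n m"
  shows "\<exists>P. unitary_mat m m P \<and>
     (\<forall>k<m. \<forall>l<m. k \<noteq> l \<longrightarrow> (\<Sum>i<n. cnj ((M * P) $$ (i,k)) * (M * P) $$ (i,l)) = 0) \<and>
     trace_norm M = (\<Sum>k<m. vnorm n (\<lambda>i. (M * P) $$ (i,k)))"
proof -
  obtain P d where U: "unitary_mat m m P" and d: "\<And>i. i < m \<Longrightarrow> d i \<ge> 0"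
    and A: "adj M * M = P * mat_diag m (\<lambda>i. complex_of_real (d i)) * adj P"
    using psd_diagonalization[OF psd_adj_mult[OF M]] by blast
  let ?D = "mat_diag m (\<lambda>i. complex_of_real (d i))"
  have P: "P \<in> carrier_mat m m" "adj P * P = 1\<^sub>m m" using U by (auto simp: unitary_mat_def)
  have MP: "M * P \<in> carrier_mat n m" using M P by auto
  have "adj (M * P) * (M * P) = adj P * ((adj M * M) * P)"
    using M P(1) by (simp add: adj_mult[of M n m P m] assoc_mult_mat[of _ m m _ n _ m]
        assoc_mult_mat[of _ m n _ m _ m] mult_carrier_mat[of _ n m _ m])
  also have "\<dots> = (adj P * P) * ?D * (adj P * P)"
    using P(1) unfolding A
    by (simp add: assoc_mult_mat[of _ m m _ m _ m] mult_carrier_mat[of _ m m _ m])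
  also have "\<dots> = ?D" using P(2) by simp
  finally have D: "adj (M * P) * (M * P) = ?D" .
  have gram: "(\<Sum>i<n. cnj ((M * P) $$ (i,k)) * (M * P) $$ (i,l)) = (if k = l then complex_of_real (d k) else 0)"
    if "k < m" "l < m" for k l
  proof -
    have "(adj (M * P) * (M * P)) $$ (k,l) = (\<Sum>i<n. cnj ((M * P) $$ (i,k)) * (M * P) $$ (i,l))"
      using M P(1) that by (subst index_mult_mat_sum[of _ m n _ m]) auto
    moreover have "?D $$ (k,l) = (if k = l then complex_of_real (d k) else 0)"
      using that by (simp add: mat_diag_def)
    ultimately show ?thesis unfolding D by simp
  qed
  have "sqrt (d k) = vnorm n (\<lambda>i. (M * P) $$ (i,k))" if "k < m" for k
  proof -
    have "(vnorm n (\<lambda>i. (M * P) $$ (i,k)))\<^sup>2 = d k"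
      using gram[OF that that] of_real_vnorm_sq[of n "\<lambda>i. (M * P) $$ (i,k)"] of_real_eq_iff by fastforce
    then show ?thesis by (metis real_sqrt_unique vnorm_nonneg)
  qed
  moreover have "trace_norm M = (\<Sum>k<m. sqrt (d k))"
    using msqrt_conj_diag[OF U, of d] d by (simp add: trace_norm_def A mtrace_conj_diag[OF U])
  ultimately show ?thesis using U gram by (intro exI[of _ P]) auto
qed

lemma trace_norm_nonneg: "trace_norm M \<ge> 0"
  using trace_norm_singular_vectors[of M "dim_row M" "dim_col M"] by (auto intro!: sum_nonneg)

lemma index_mult_unitary_adj:
  assumes "M \<in> carrier_mat n m" "unitary_mat m m P" "i < n" "j < m"
  shows "M $$ (i,j) = (\<Sum>k<m. (M * P) $$ (i,k) * cnj (P $$ (j,k)))"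
proof -
  have P: "P \<in> carrier_mat m m" "P * adj P = 1\<^sub>m m" using assms by (auto simp: unitary_mat_def)
  have "M = M * P * adj P" using assms(1) P by (simp add: assoc_mult_mat[of _ n m _ m _ m])
  then have "M $$ (i,j) = (M * P * adj P) $$ (i,j)" by simp
  also have "\<dots> = (\<Sum>k<m. (M * P) $$ (i,k) * adj P $$ (k,j))"
    using assms P by (subst index_mult_mat_sum[of _ n m _ m]) auto
  finally show ?thesis using assms P by simp
qed

lemma vnorm_unitary_col:
  assumes "unitary_mat m m P" "k < m"
  shows "vnorm m (\<lambda>j. P $$ (j,k)) = 1"
proof -
  have P: "P \<in> carrier_mat m m" "adj P * P = 1\<^sub>m m" using assms by (auto simp: unitary_mat_def)
  have "complex_of_real ((vnorm m (\<lambda>j. P $$ (j,k)))\<^sup>2) = (adj P * P) $$ (k,k)"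
    unfolding of_real_vnorm_sq using P(1) assms(2) by (subst index_mult_mat_sum[of _ m m _ m]) auto
  also have "\<dots> = 1" using P assms(2) by simp
  finally have "(vnorm m (\<lambda>j. P $$ (j,k)))\<^sup>2 = 1" using of_real_eq_1_iff by blast
  then show ?thesis by (metis power2_eq_1_iff vnorm_nonneg not_one_le_zero neg_0_le_iff_le order.trans zero_le_one) 
qed

text \<open>The singular value decomposition with the singular values absorbed into
  \<open>x\<close>: expand \<open>M\<close> as \<open>(M * P) * adj P\<close>, where the columns of
  \<open>P\<close> have norm 1.\<close>

lemma rank_one_decomposition:
  assumes M: "M \<in> carrier_mat n m"
  shows "\<exists>x y. (\<forall>i<n. \<forall>j<m. M $$ (i,j) = (\<Sum>k<m. x k i * cnj (y k j))) \<and>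
     trace_norm M = (\<Sum>k<m. vnorm n (x k) * vnorm m (y k))"
proof -
  obtain P where U: "unitary_mat m m P" and t: "trace_norm M = (\<Sum>k<m. vnorm n (\<lambda>i. (M * P) $$ (i,k)))"
    using trace_norm_singular_vectors[OF M] by blast
  show ?thesis
    using index_mult_unitary_adj[OF M U] t vnorm_unitary_col[OF U]
    by (intro exI[of _ "\<lambda>k i. (M * P) $$ (i,k)"] exI[of _ "\<lambda>k j. P $$ (j,k)"]) simp
qed

lemma hs_inner_rank_one:
  "hs_inner n m W (\<lambda>i j. x i * cnj (y j)) = cnj (\<Sum>i<n. \<Sum>j<m. cnj (x i) * W i j * y j)"
  by (simp add: hs_inner_def mult_ac)

lemma contraction_hs_inner_rank_one:
  "contraction n m W \<Longrightarrow> cmod (hs_inner n m W (\<lambda>i j. x i * cnj (y j))) \<le> vnorm n x * vnorm m y"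
  unfolding hs_inner_rank_one complex_mod_cnj by (auto simp: contraction_def)

lemma hs_inner_sum:
  "hs_inner n m W (\<lambda>i j. \<Sum>k\<in>K. F k i j) = (\<Sum>k\<in>K. hs_inner n m W (F k))"
proof -
  have "hs_inner n m W (\<lambda>i j. \<Sum>k\<in>K. F k i j) = (\<Sum>i<n. \<Sum>j<m. \<Sum>k\<in>K. cnj (W i j) * F k i j)"
    by (simp add: hs_inner_def sum_distrib_left)
  also have "\<dots> = (\<Sum>i<n. \<Sum>k\<in>K. \<Sum>j<m. cnj (W i j) * F k i j)"
    by (intro sum.cong refl sum.swap)
  also have "\<dots> = (\<Sum>k\<in>K. hs_inner n m W (F k))"
    unfolding hs_inner_def by (rule sum.swap)
  finally show ?thesis .
qed

lemma hs_inner_cong: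
  "(\<And>i j. i < n \<Longrightarrow> j < m \<Longrightarrow> W i j = W' i j) \<Longrightarrow> (\<And>i j. i < n \<Longrightarrow> j < m \<Longrightarrow> M i j = M' i j) \<Longrightarrow>
    hs_inner n m W M = hs_inner n m W' M'"
  by (simp add: hs_inner_def)

text \<open>Each rank-one term of the singular value decomposition contributes at most the product
  of its two norms, and these products sum to the trace norm.\<close>

lemma hs_inner_le_trace_norm:
  assumes M: "M \<in> carrier_mat n m" and W: "contraction n m W"
  shows "cmod (hs_inner n m W (\<lambda>i j. M $$ (i,j))) \<le> trace_norm M"
proof -
  obtain x y where xy: "\<And>i j. i < n \<Longrightarrow> j < m \<Longrightarrow> M $$ (i,j) = (\<Sum>k<m. x k i * cnj (y k j))"
    and t: "trace_norm M = (\<Sum>k<m. vnorm n (x k) * vnorm m (y k))"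
    using rank_one_decomposition[OF M] by blast
  have "hs_inner n m W (\<lambda>i j. M $$ (i,j)) = (\<Sum>k<m. hs_inner n m W (\<lambda>i j. x k i * cnj (y k j)))"
    unfolding hs_inner_sum[symmetric] by (rule hs_inner_cong) (simp_all add: xy)
  also have "cmod \<dots> \<le> (\<Sum>k<m. vnorm n (x k) * vnorm m (y k))"
    by (rule order.trans[OF norm_sum]) (intro sum_mono contraction_hs_inner_rank_one W)
  finally show ?thesis unfolding t .
qed

lemma vnorm_sum_orthogonal:
  assumes e: "\<And>k l. k < m \<Longrightarrow> l < m \<Longrightarrow> (\<Sum>i<n. cnj (e i k) * e i l) = (if k = l then complex_of_real (s k) else 0)"
    and s: "\<And>k. k < m \<Longrightarrow> s k \<le> 1"
  shows "vnorm n (\<lambda>i. \<Sum>k<m. e i k * b k) \<le> vnorm m b"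
proof -
  have "complex_of_real ((vnorm n (\<lambda>i. \<Sum>k<m. e i k * b k))\<^sup>2)
      = (\<Sum>i<n. \<Sum>k<m. \<Sum>l<m. (cnj (b k) * b l) * (cnj (e i k) * e i l))"
    unfolding of_real_vnorm_sq cnj_sum sum_product by (simp add: mult_ac)
  also have "\<dots> = (\<Sum>k<m. \<Sum>l<m. (cnj (b k) * b l) * (\<Sum>i<n. cnj (e i k) * e i l))"
    unfolding sum_distrib_left by (subst sum.swap, subst (2) sum.swap) (rule refl)
  also have "\<dots> = (\<Sum>k<m. \<Sum>l<m. if l = k then (cnj (b k) * b l) * complex_of_real (s k) else 0)"
    by (intro sum.cong refl) (auto simp: e)
  also have "\<dots> = (\<Sum>k<m. complex_of_real (s k * (cmod (b k))\<^sup>2))"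
    by (intro sum.cong refl) (simp add: complex_norm_square mult_ac del: of_real_power)
  finally have "(vnorm n (\<lambda>i. \<Sum>k<m. e i k * b k))\<^sup>2 = (\<Sum>k<m. s k * (cmod (b k))\<^sup>2)"
    unfolding of_real_sum[symmetric] of_real_eq_iff .
  also have "\<dots> \<le> (\<Sum>k<m. 1 * (cmod (b k))\<^sup>2)"
    by (intro sum_mono mult_right_mono) (auto simp: s)
  also have "\<dots> = (vnorm m b)\<^sup>2" by (simp add: vnorm_sq)
  finally show ?thesis by (rule power2_le_imp_le) simp
qed

text \<open>The optimal contraction is the partial isometry of the polar decomposition of \<open>M\<close>.  Its factors
  \<open>inverse (vnorm n ...)\<close> vanish on the kernel of \<open>M\<close>, since \<open>inverse 0 = 0\<close>.\<close>

lemma trace_norm_attained: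
  assumes M: "M \<in> carrier_mat n m"
  shows "\<exists>W. contraction n m W \<and> hs_inner n m W (\<lambda>i j. M $$ (i,j)) = complex_of_real (trace_norm M)"
proof -
  obtain P where U: "unitary_mat m m P"
    and orth: "\<And>k l. k < m \<Longrightarrow> l < m \<Longrightarrow> k \<noteq> l \<Longrightarrow> (\<Sum>i<n. cnj ((M * P) $$ (i,k)) * (M * P) $$ (i,l)) = 0"
    and t: "trace_norm M = (\<Sum>k<m. vnorm n (\<lambda>i. (M * P) $$ (i,k)))"
    using trace_norm_singular_vectors[OF M] by blast
  have P: "P \<in> carrier_mat m m" "adj P * P = 1\<^sub>m m" "P * adj P = 1\<^sub>m m"
    using U by (auto simp: unitary_mat_def)
  define s where "s k = vnorm n (\<lambda>i. (M * P) $$ (i,k))" for k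
  define e where "e i k = complex_of_real (inverse (s k)) * (M * P) $$ (i,k)" for i k
  define W where "W i j = (\<Sum>k<m. e i k * cnj (P $$ (j,k)))" for i j
  have ss: "(\<Sum>i<n. cnj ((M * P) $$ (i,k)) * (M * P) $$ (i,k)) = complex_of_real ((s k)\<^sup>2)" for k
    unfolding s_def of_real_vnorm_sq ..
  have ee: "(\<Sum>i<n. cnj (e i k) * e i l) = (if k = l then complex_of_real (if s k = 0 then 0 else 1) else 0)"
    if "k < m" "l < m" for k l
  proof -
    have "(\<Sum>i<n. cnj (e i k) * e i l) = complex_of_real (inverse (s k) * inverse (s l)) *
        (\<Sum>i<n. cnj ((M * P) $$ (i,k)) * (M * P) $$ (i,l))"
      by (simp add: e_def sum_distrib_left mult_ac)
    then show ?thesis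
      using orth[OF that] ss[of k] by (cases "s k = 0") (auto simp: power2_eq_square field_simps)
  qed
  have PP: "(\<Sum>j<m. cnj (P $$ (j,k)) * P $$ (j,l)) = (if k = l then 1 else 0)" if "k < m" "l < m" for k l
  proof -
    have "(adj P * P) $$ (k,l) = (\<Sum>j<m. cnj (P $$ (j,k)) * P $$ (j,l))"
      using P(1) that by (subst index_mult_mat_sum[of _ m m _ m]) auto
    then show ?thesis using P(2) that by simp
  qed
  have PP': "(\<Sum>k<m. P $$ (i,k) * cnj (P $$ (j,k))) = (if i = j then 1 else 0)" if "i < m" "j < m" for i j
  proof -
    have "(P * adj P) $$ (i,j) = (\<Sum>k<m. P $$ (i,k) * cnj (P $$ (j,k)))"
      using P(1) that by (subst index_mult_mat_sum[of _ m m _ m]) auto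
    then show ?thesis using P(3) that by simp
  qed
  have "contraction n m W"
    unfolding contraction_def
  proof (intro allI)
    fix a b :: "nat \<Rightarrow> complex"
    \<comment> \<open>\<open>W\<close> first applies \<open>adj P\<close>, sending \<open>b\<close>
      to \<open>\<beta>\<close>, and then combines the columns of \<open>e\<close>; neither factor
      increases the norm.\<close>
    define \<beta> where "\<beta> k = (\<Sum>j<m. cnj (P $$ (j,k)) * b j)" for k
    have "vnorm m \<beta> \<le> vnorm m b"
      unfolding \<beta>_def
    proof (rule vnorm_sum_orthogonal[where s = "\<lambda>_. 1"])
      show "(\<Sum>k<m. cnj (cnj (P $$ (i,k))) * cnj (P $$ (j,k))) = (if i = j then complex_of_real 1 else 0)"
        if "i < m" "j < m" for i j
        using PP'[OF that] by simp
    qed simp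
    have "(\<Sum>j<m. W i j * b j) = (\<Sum>k<m. e i k * \<beta> k)" for i
      unfolding W_def \<beta>_def sum_distrib_left sum_distrib_right
      by (subst sum.swap) (simp add: mult_ac)
    then have "(\<Sum>i<n. \<Sum>j<m. cnj (a i) * W i j * b j) = (\<Sum>i<n. cnj (a i) * (\<Sum>k<m. e i k * \<beta> k))"
      by (metis (no_types, lifting) sum.cong sum_distrib_left mult.assoc)
    also have "cmod \<dots> \<le> vnorm n (\<lambda>i. cnj (a i)) * vnorm n (\<lambda>i. \<Sum>k<m. e i k * \<beta> k)"
      by (rule cmod_sum_mult_le_vnorm)
    also have "\<dots> \<le> vnorm n a * vnorm m \<beta>"
      using ee by (auto intro!: mult_left_mono vnorm_sum_orthogonal[where s = "\<lambda>k. if s k = 0 then 0 else 1"])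
    also have "\<dots> \<le> vnorm n a * vnorm m b"
      using \<open>vnorm m \<beta> \<le> vnorm m b\<close> by (intro mult_left_mono) simp_all
    finally show "cmod (\<Sum>i<n. \<Sum>j<m. cnj (a i) * W i j * b j) \<le> vnorm n a * vnorm m b" .
  qed
  moreover have "hs_inner n m W (\<lambda>i j. M $$ (i,j)) = complex_of_real (trace_norm M)"
  proof -
    \<comment> \<open>\<open>W\<close> maps the right singular vector \<open>k\<close> to the
      normalized left singular vector, or to 0 where the singular value vanishes.\<close>
    have W_P: "(\<Sum>j<m. W i j * P $$ (j,k)) = e i k" if "k < m" for i k
    proof -
      have "(\<Sum>j<m. W i j * P $$ (j,k)) = (\<Sum>l<m. e i l * (\<Sum>j<m. cnj (P $$ (j,l)) * P $$ (j,k)))"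
        unfolding W_def sum_distrib_left sum_distrib_right by (subst sum.swap) (simp add: mult_ac)
      also have "\<dots> = (\<Sum>l<m. if l = k then e i l else 0)"
        by (intro sum.cong refl) (auto simp: PP that)
      finally show ?thesis using that by simp
    qed
    have "hs_inner n m W (\<lambda>i j. M $$ (i,j)) = (\<Sum>k<m. hs_inner n m W (\<lambda>i j. (M * P) $$ (i,k) * cnj (P $$ (j,k))))"
      unfolding hs_inner_sum[symmetric] by (rule hs_inner_cong) (simp_all add: index_mult_unitary_adj[OF M U])
    also have "\<dots> = (\<Sum>k<m. complex_of_real (s k))"
    proof (intro sum.cong refl)
      fix k assume "k \<in> {..<m}"
      then have k: "k < m" by simp
      have "hs_inner n m W (\<lambda>i j. (M * P) $$ (i,k) * cnj (P $$ (j,k)))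
          = cnj (\<Sum>i<n. cnj ((M * P) $$ (i,k)) * (\<Sum>j<m. W i j * P $$ (j,k)))"
        unfolding hs_inner_rank_one sum_distrib_left by (simp add: mult_ac)
      also have "\<dots> = cnj (complex_of_real (inverse (s k)) * (\<Sum>i<n. cnj ((M * P) $$ (i,k)) * (M * P) $$ (i,k)))"
        unfolding W_P[OF k] e_def sum_distrib_left by (simp add: mult_ac)
      also have "\<dots> = complex_of_real (s k)"
        unfolding ss by (cases "s k = 0") (simp_all add: power2_eq_square)
      finally show "hs_inner n m W (\<lambda>i j. (M * P) $$ (i,k) * cnj (P $$ (j,k))) = complex_of_real (s k)" .
    qed
    finally show ?thesis unfolding t s_def by simp
  qed
  ultimately show ?thesis by blast
qed

section \<open>Transposes, adjoints and the fidelity as a trace norm\<close>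

lemma contractionD:
  "contraction n m W \<Longrightarrow> cmod (\<Sum>i<n. \<Sum>j<m. cnj (a i) * W i j * b j) \<le> vnorm n a * vnorm m b"
  by (simp add: contraction_def)

lemma contraction_transpose:
  assumes "contraction n m W"
  shows "contraction m n (\<lambda>i j. W j i)"
  unfolding contraction_def
proof (intro allI)
  fix a b :: "nat \<Rightarrow> complex"
  have "(\<Sum>i<m. \<Sum>j<n. cnj (a i) * W j i * b j) = (\<Sum>j<n. \<Sum>i<m. cnj (cnj (b j)) * W j i * cnj (a i))"
    by (subst sum.swap) (simp add: mult_ac)
  also have "cmod \<dots> \<le> vnorm n (\<lambda>j. cnj (b j)) * vnorm m (\<lambda>i. cnj (a i))"
    by (rule contractionD[OF assms])
  finally show "cmod (\<Sum>i<m. \<Sum>j<n. cnj (a i) * W j i * b j) \<le> vnorm m a * vnorm n b"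
    by (simp add: mult.commute)
qed

lemma contraction_adjoint:
  assumes "contraction n m W"
  shows "contraction m n (\<lambda>i j. cnj (W j i))"
  unfolding contraction_def
proof (intro allI)
  fix a b :: "nat \<Rightarrow> complex"
  have "(\<Sum>i<m. \<Sum>j<n. cnj (a i) * cnj (W j i) * b j) = cnj (\<Sum>j<n. \<Sum>i<m. cnj (b j) * W j i * a i)"
    by (subst sum.swap) (simp add: mult_ac)
  also have "cmod \<dots> \<le> vnorm n b * vnorm m a"
    unfolding complex_mod_cnj by (rule contractionD[OF assms])
  finally show "cmod (\<Sum>i<m. \<Sum>j<n. cnj (a i) * cnj (W j i) * b j) \<le> vnorm m a * vnorm n b"
    by (simp add: mult.commute)
qed

text \<open>An optimal contraction for the transpose becomes, after transposition, a competitor for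
  \<open>M\<close>.\<close>

lemma trace_norm_transpose_le:
  assumes M: "M \<in> carrier_mat n m"
  shows "trace_norm (transpose_mat M) \<le> trace_norm M"
proof -
  obtain W where W: "contraction m n W"
    and eq: "hs_inner m n W (\<lambda>i j. transpose_mat M $$ (i,j)) = complex_of_real (trace_norm (transpose_mat M))"
    using trace_norm_attained[of "transpose_mat M" m n] M by auto
  have "hs_inner m n W (\<lambda>i j. transpose_mat M $$ (i,j)) = hs_inner n m (\<lambda>i j. W j i) (\<lambda>i j. M $$ (i,j))"
    unfolding hs_inner_def using M by (subst sum.swap) simp
  then have "trace_norm (transpose_mat M) = cmod (hs_inner n m (\<lambda>i j. W j i) (\<lambda>i j. M $$ (i,j)))"
    using eq trace_norm_nonneg[of "transpose_mat M"] by (metis norm_of_real abs_of_nonneg)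
  also have "\<dots> \<le> trace_norm M"
    by (rule hs_inner_le_trace_norm[OF M contraction_transpose[OF W]])
  finally show ?thesis .
qed

lemma trace_norm_transpose: "trace_norm (transpose_mat M) = trace_norm M"
  using trace_norm_transpose_le[of M "dim_row M" "dim_col M"]
    trace_norm_transpose_le[of "transpose_mat M" "dim_col M" "dim_row M"] by simp

text \<open>The trace norm of \<open>A * B\<close> sees \<open>A\<close> only through its Gram
  matrix \<open>adj A * A\<close>, so \<open>A\<close> may be exchanged for a matrix with a
  different number of rows.\<close>

lemma trace_norm_gram_cong:
  assumes A: "A \<in> carrier_mat n k" and A': "A' \<in> carrier_mat n' k" and B: "B \<in> carrier_mat k m"
    and eq: "adj A * A = adj A' * A'"
  shows "trace_norm (A * B) = trace_norm (A' * B)"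
proof -
  have "adj (X * B) * (X * B) = adj B * ((adj X * X) * B)" if "X \<in> carrier_mat l k" for X l
    using that B
    by (simp add: adj_mult[of X l k B m] assoc_mult_mat[of "adj B" m k "adj X" l _ m]
        assoc_mult_mat[of "adj X" k l X k B m])
  then show ?thesis using A A' eq by (metis trace_norm_def)
qed

text \<open>A form of Uhlmann's theorem. With \<open>S\<close> the root of
  \<open>G1 * adj G1\<close>, the fidelity is the trace norm of \<open>adj G2 * S\<close>; after
  transposition, \<open>S\<close> can be exchanged for \<open>G1\<close> because their transposes
  have the same Gram matrix.\<close>

lemma fidelity_eq_trace_norm:
  assumes G1: "G1 \<in> carrier_mat k m" and G2: "G2 \<in> carrier_mat k m"
  shows "fidelity (G1 * adj G1) (G2 * adj G2) = trace_norm (transpose_mat G1 * map_mat cnj G2)"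
proof -
  define S where "S = msqrt (G1 * adj G1)"
  have S: "S \<in> carrier_mat k k" and Sh: "adj S = S" and SS: "S * S = G1 * adj G1"
    using psd_msqrt[OF psd_mult_adj[OF G1]] unfolding S_def by (auto simp: psd_def)
  have tadj: "transpose_mat (adj A) = map_mat cnj A" "adj (transpose_mat A) = map_mat cnj A" for A
    by (rule eq_matI; simp)+
  have "adj (adj G2 * S) * (adj G2 * S) = S * (G2 * adj G2) * S"
    using G2 S Sh mult_carrier_mat[OF adj_carrier[OF G2] S] mult_carrier_mat[OF G2 adj_carrier[OF G2]]
    by (simp add: adj_mult[of "adj G2" m k S k] assoc_mult_mat[of S k k G2 m _ k]
        assoc_mult_mat[of S k k "G2 * adj G2" k S k] assoc_mult_mat[of G2 k m "adj G2" k S k]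
        assoc_mult_mat[of S k k G2 m "adj G2 * S" k])
  then have "fidelity (G1 * adj G1) (G2 * adj G2) = trace_norm (adj G2 * S)"
    unfolding fidelity_def trace_norm_def S_def[symmetric] by simp
  also have "\<dots> = trace_norm (transpose_mat (adj G2 * S))"
    by (rule trace_norm_transpose[symmetric])
  also have "transpose_mat (adj G2 * S) = transpose_mat S * map_mat cnj G2"
    using G2 S by (simp add: transpose_mult[of "adj G2" m k S k] tadj)
  also have "trace_norm \<dots> = trace_norm (transpose_mat G1 * map_mat cnj G2)"
  proof (rule trace_norm_gram_cong[of _ k k _ m _ m])
    have *: "adj (transpose_mat A) * transpose_mat A = transpose_mat (A * adj A)" if "A \<in> carrier_mat k l" for A l
      using that by (simp add: transpose_mult[of A k l "adj A" k] tadj)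
    show "adj (transpose_mat S) * transpose_mat S = adj (transpose_mat G1) * transpose_mat G1"
      unfolding *[OF S] *[OF G1] using Sh SS by simp
  qed (use S G1 G2 in auto)
  finally show ?thesis .
qed

section \<open>Direct sums, block contractions and rank-one operators\<close>

lemma sum_lessThan_add:
  fixes f :: "nat \<Rightarrow> 'a::comm_monoid_add"
  shows "(\<Sum>i<n + k. f i) = (\<Sum>i<n. f i) + (\<Sum>i<k. f (n + i))"
  by (induction k) (simp_all add: add.assoc)

lemma vnorm_sq_add: "(vnorm (n + k) x)\<^sup>2 = (vnorm n x)\<^sup>2 + (vnorm k (\<lambda>i. x (n + i)))\<^sup>2"
  by (simp add: vnorm_sq sum_lessThan_add)

lemma vnorm_le_add: "vnorm n x \<le> vnorm (n + k) x" "vnorm k (\<lambda>i. x (n + i)) \<le> vnorm (n + k) x"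
  by (rule power2_le_imp_le; simp add: vnorm_sq_add)+

text \<open>Padding the test vectors with zeros, \<open>a\<close> behind and \<open>b\<close> in
  front, turns the form of the block into the form of \<open>W\<close> without changing the
  norms.\<close>

lemma contraction_upper_block:
  assumes "contraction (m + m) (m + m) W"
  shows "contraction m m (\<lambda>i j. W i (m + j))"
  unfolding contraction_def
proof (intro allI)
  fix a b :: "nat \<Rightarrow> complex"
  define a' where "a' i = (if i < m then a i else 0)" for i
  define b' where "b' i = (if i < m then 0 else b (i - m))" for i
  have "(vnorm (m + m) a')\<^sup>2 = (vnorm m a)\<^sup>2" "(vnorm (m + m) b')\<^sup>2 = (vnorm m b)\<^sup>2"
    by (simp_all add: vnorm_sq sum_lessThan_add a'_def b'_def)
  then have n: "vnorm (m + m) a' = vnorm m a" "vnorm (m + m) b' = vnorm m b"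
    by (simp_all only: power2_eq_iff_nonneg vnorm_nonneg)
  have "(\<Sum>i<m. \<Sum>j<m. cnj (a i) * W i (m + j) * b j) = (\<Sum>i<m+m. \<Sum>j<m+m. cnj (a' i) * W i j * b' j)"
    by (simp add: sum_lessThan_add a'_def b'_def)
  then show "cmod (\<Sum>i<m. \<Sum>j<m. cnj (a i) * W i (m + j) * b j) \<le> vnorm m a * vnorm m b"
    using contractionD[OF assms, of a' b'] n by simp
qed

lemma contraction_lower_block:
  assumes "contraction (m + m) (m + m) W"
  shows "contraction m m (\<lambda>i j. W (m + i) j)"
  using contraction_transpose[OF contraction_upper_block[OF contraction_transpose[OF assms]]] .

text \<open>The extended form reads only the first half of \<open>a\<close> and the second half of
  \<open>b\<close>, whose norms are bounded by those of the whole vectors.\<close>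

lemma contraction_embed_upper_block:
  assumes "contraction m m W"
  shows "contraction (m + m) (m + m) (\<lambda>i j. if i < m \<and> m \<le> j then W i (j - m) else 0)"
  unfolding contraction_def
proof (intro allI)
  fix a b :: "nat \<Rightarrow> complex"
  have "(\<Sum>i<m+m. \<Sum>j<m+m. cnj (a i) * (if i < m \<and> m \<le> j then W i (j - m) else 0) * b j)
      = (\<Sum>i<m. \<Sum>j<m. cnj (a i) * W i j * b (m + j))"
    by (simp add: sum_lessThan_add)
  also have "cmod \<dots> \<le> vnorm m a * vnorm m (\<lambda>j. b (m + j))"
    by (rule contractionD[OF assms])
  also have "\<dots> \<le> vnorm (m + m) a * vnorm (m + m) b"
    by (intro mult_mono vnorm_le_add) simp_all
  finally show "cmod (\<Sum>i<m+m. \<Sum>j<m+m. cnj (a i) * (if i < m \<and> m \<le> j then W i (j - m) else 0) * b j)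
      \<le> vnorm (m + m) a * vnorm (m + m) b" .
qed

lemma contraction_rank_one:
  assumes "vnorm n x \<le> 1" "vnorm m y \<le> 1"
  shows "contraction n m (\<lambda>i j. x i * cnj (y j))"
  unfolding contraction_def
proof (intro allI)
  fix a b :: "nat \<Rightarrow> complex"
  have "(\<Sum>i<n. \<Sum>j<m. cnj (a i) * (x i * cnj (y j)) * b j) = (\<Sum>i<n. cnj (a i) * x i) * (\<Sum>j<m. cnj (y j) * b j)"
    unfolding sum_product by (simp add: mult_ac)
  also have "cmod \<dots> \<le> (vnorm n (\<lambda>i. cnj (a i)) * vnorm n x) * (vnorm m (\<lambda>j. cnj (y j)) * vnorm m b)"
    unfolding norm_mult by (intro mult_mono cmod_sum_mult_le_vnorm) simp_all
  also have "\<dots> = (vnorm n x * vnorm m y) * (vnorm n a * vnorm m b)"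
    by (simp add: mult_ac)
  also have "\<dots> \<le> 1 * (vnorm n a * vnorm m b)"
    using assms by (intro mult_right_mono) (auto simp: mult_le_one)
  finally show "cmod (\<Sum>i<n. \<Sum>j<m. cnj (a i) * (x i * cnj (y j)) * b j) \<le> vnorm n a * vnorm m b"
    by simp
qed

text \<open>Every contraction pairs with a rank-one operator to at most the product of the norms,
  and the operator itself is a contraction that reaches 1.\<close>

lemma trace_norm_rank_one:
  assumes "vnorm n x = 1" "vnorm m y = 1"
  shows "trace_norm (mat n m (\<lambda>(i,j). x i * cnj (y j))) = 1" (is "trace_norm ?M = 1")
proof (rule antisym)
  have M: "?M \<in> carrier_mat n m" by simp
  have h: "hs_inner n m W (\<lambda>i j. ?M $$ (i,j)) = hs_inner n m W (\<lambda>i j. x i * cnj (y j))" for W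
    by (rule hs_inner_cong) simp_all
  obtain W where W: "contraction n m W" "hs_inner n m W (\<lambda>i j. ?M $$ (i,j)) = complex_of_real (trace_norm ?M)"
    using trace_norm_attained[OF M] by blast
  have "trace_norm ?M = cmod (hs_inner n m W (\<lambda>i j. x i * cnj (y j)))"
    using W(2) unfolding h by (simp add: trace_norm_nonneg)
  also have "\<dots> \<le> 1"
    using contraction_hs_inner_rank_one[OF W(1), of x y] assms by simp
  finally show "trace_norm ?M \<le> 1" .
  have "hs_inner n m (\<lambda>i j. x i * cnj (y j)) (\<lambda>i j. x i * cnj (y j))
      = (\<Sum>i<n. cnj (x i) * x i) * (\<Sum>j<m. cnj (y j) * y j)"
    unfolding hs_inner_def sum_product by (simp add: mult_ac)
  also have "\<dots> = 1" using assms unfolding of_real_vnorm_sq[symmetric] by simp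
  finally have "cmod (hs_inner n m (\<lambda>i j. x i * cnj (y j)) (\<lambda>i j. ?M $$ (i,j))) = 1"
    unfolding h by simp
  then show "1 \<le> trace_norm ?M"
    using hs_inner_le_trace_norm[OF M contraction_rank_one[of n x m y]] assms by simp
qed

lemma vnorm_eq_1: "(vnorm n x)\<^sup>2 = 1 \<Longrightarrow> vnorm n x = 1"
  using vnorm_nonneg[of n x] by (auto simp: power2_eq_1_iff)

text \<open>Testing on basis vectors bounds the entries, which confines contractions to a product of
  discs.\<close>

lemma contraction_entry_le_1:
  assumes W: "contraction n m W" and ij: "i < n" "j < m"
  shows "cmod (W i j) \<le> 1"
proof -
  have v: "vnorm l (\<lambda>k. if k = t then 1 else 0) = 1" if "t < l" for l t
  proof -
    have "(vnorm l (\<lambda>k. if k = t then 1 else 0))\<^sup>2 = 1"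
      using that by (simp add: vnorm_sq if_distrib[of cmod] if_distrib[of "\<lambda>x. x\<^sup>2"] cong: if_cong)
    then show ?thesis by (rule vnorm_eq_1)
  qed
  have "(\<Sum>k<n. \<Sum>l<m. cnj (if k = i then 1 else 0) * W k l * (if l = j then 1 else 0)) = W i j"
    using ij by (simp add: if_distrib[of cnj] if_distrib[of "\<lambda>x. x * _"] if_distrib[of "\<lambda>x. _ * x"] cong: if_cong)
  then have "cmod (W i j) \<le> vnorm n (\<lambda>k. if k = i then 1 else 0) * vnorm m (\<lambda>k. if k = j then 1 else 0)"
    using contractionD[OF W, of "\<lambda>k. if k = i then 1 else 0" "\<lambda>k. if k = j then 1 else 0"] by simp
  then show ?thesis using v ij by simp
qed

section \<open>Compactness\<close>

text \<open>Tychonoff's theorem, carried over from the abstract product topology to the topology of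
  the function type.\<close>

lemma compact_PiE_UNIV:
  fixes S :: "'i \<Rightarrow> 'a::topological_space set"
  assumes "\<And>i. compact (S i)"
  shows "compact (PiE UNIV S)"
proof -
  have "compactin (product_topology (\<lambda>i. euclidean) UNIV) (PiE UNIV S)"
    unfolding compactin_PiE using assms by simp
  then show ?thesis by (simp add: euclidean_product_topology)
qed

text \<open>Values from \<open>n\<close> on are pinned to 0, since \<open>vnorm n\<close> does not
  bound them; the sphere is then a closed part of a product of discs and singletons.\<close>

lemma compact_unit_sphere:
  "compact {x. vnorm n x = 1 \<and> (\<forall>i\<ge>n. x i = 0)}" (is "compact ?S")
proof -
  let ?B = "PiE UNIV (\<lambda>i. if i < n then cball (0::complex) 1 else {0::complex})"
  have "compact ?B" by (rule compact_PiE_UNIV) simp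
  moreover have "closed {x. (vnorm n x)\<^sup>2 = 1}"
    unfolding vnorm_sq by (intro closed_Collect_eq continuous_intros continuous_on_product_coordinates)
  moreover have "?S = {x. (vnorm n x)\<^sup>2 = 1} \<inter> ?B"
  proof safe
    fix x i assume "vnorm n x = 1"
    have "(cmod (x i))\<^sup>2 \<le> 1" if "i < n"
    proof -
      have "(cmod (x i))\<^sup>2 \<le> (\<Sum>i<n. (cmod (x i))\<^sup>2)"
        using that by (intro member_le_sum) auto
      then show ?thesis using \<open>vnorm n x = 1\<close> by (simp flip: vnorm_sq)
    qed
    then show "x i \<in> (if i < n then cball (0::complex) 1 else {0::complex})" if "\<forall>i\<ge>n. x i = 0"
      using that by (auto simp: abs_square_le_1)
  next
    fix x assume "(vnorm n x)\<^sup>2 = 1"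
    then show "vnorm n x = 1" by (rule vnorm_eq_1)
  next
    fix x i assume "x \<in> ?B" "n \<le> i"
    then show "x i = 0" by (auto simp: PiE_def Pi_def dest!: spec[of _ i])
  qed auto
  ultimately show ?thesis by (simp add: closed_Int_compact)
qed

text \<open>An intersection of closed conditions, one for each pair of test vectors, inside a
  product of discs and singletons.\<close>

lemma compact_contractions:
  "compact {W. contraction n m W \<and> (\<forall>i j. i \<ge> n \<or> j \<ge> m \<longrightarrow> W i j = 0)}" (is "compact ?S")
proof -
  let ?B = "PiE UNIV (\<lambda>i. PiE UNIV (\<lambda>j. if i < n \<and> j < m then cball (0::complex) 1 else {0::complex}))"
  have "compact ?B" by (intro compact_PiE_UNIV) simp
  moreover have "closed {W. contraction n m W}"
    unfolding contraction_def
    by (intro closed_Collect_all closed_Collect_le continuous_intros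
        continuous_on_product_then_coordinatewise[OF continuous_on_product_coordinates])
  moreover have "?S = {W. contraction n m W} \<inter> ?B"
    unfolding PiE_UNIV_domain Pi_iff set_eq_iff Int_iff mem_Collect_eq
  proof (intro allI iffI conjI ballI)
    fix W i j assume *: "contraction n m W \<and> (\<forall>i j. i \<ge> n \<or> j \<ge> m \<longrightarrow> W i j = 0)"
    then show "W i j \<in> (if i < n \<and> j < m then cball 0 1 else {0})"
      using contraction_entry_le_1[of n m W i j] by auto
  next
    fix W i j
    assume *: "contraction n m W \<and>
      (\<forall>i\<in>UNIV. \<forall>j\<in>UNIV. W i j \<in> (if i < n \<and> j < m then cball 0 1 else {0}))"
    show "i \<ge> n \<or> j \<ge> m \<longrightarrow> W i j = 0"
      using *[THEN conjunct2, THEN bspec[OF _ UNIV_I], THEN bspec[OF _ UNIV_I], of i j]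
      by (auto split: if_splits)
  qed auto
  ultimately show ?thesis by (simp add: closed_Int_compact)
qed

text \<open>The truncation hypothesis says that \<open>f\<close> only reads the components with index in range.\<close>

lemma maximum_over_unit_vectors_and_contractions:
  fixes f :: "(nat \<Rightarrow> complex) \<Rightarrow> (nat \<Rightarrow> complex) \<Rightarrow> (nat \<Rightarrow> nat \<Rightarrow> complex) \<Rightarrow> real"
  assumes n: "n > 0"
    and cont: "continuous_on UNIV (\<lambda>p. f (fst p) (fst (snd p)) (snd (snd p)))"
    and trunc: "\<And>x y W. f (\<lambda>i. if i < n then x i else 0) (\<lambda>i. if i < n then y i else 0)
        (\<lambda>i j. if i < m \<and> j < m then W i j else 0) = f x y W"
  shows "\<exists>x y W. vnorm n x = 1 \<and> vnorm n y = 1 \<and> contraction m m W \<and>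
    (\<forall>x' y' W'. vnorm n x' = 1 \<longrightarrow> vnorm n y' = 1 \<longrightarrow> contraction m m W' \<longrightarrow> f x' y' W' \<le> f x y W)"
proof -
  let ?S = "{x. vnorm n x = 1 \<and> (\<forall>i\<ge>n. x i = 0)}"
  let ?C = "{W. contraction m m W \<and> (\<forall>i j. i \<ge> m \<or> j \<ge> m \<longrightarrow> W i j = 0)}"
  let ?K = "?S \<times> ?S \<times> ?C"
  let ?t = "\<lambda>x i. if i < n then x i else (0::complex)"
  let ?T = "\<lambda>W i j. if i < m \<and> j < m then W i j else (0::complex)"
  have tS: "?t x \<in> ?S" if "vnorm n x = 1" for x
  proof -
    have "vnorm n (?t x) = vnorm n x" unfolding vnorm_def by (rule L2_set_cong) simp_all
    then show ?thesis using that by simp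
  qed
  have tC: "?T W \<in> ?C" if "contraction m m W" for W
    using that by (simp add: contraction_def)
  have "vnorm n (\<lambda>k. if k = 0 then 1 else 0) = 1"
  proof -
    have "(vnorm n (\<lambda>k. if k = 0 then 1 else 0))\<^sup>2 = 1"
      using n by (simp add: vnorm_sq if_distrib[of cmod] if_distrib[of "\<lambda>x. x\<^sup>2"] cong: if_cong)
    then show ?thesis by (rule vnorm_eq_1)
  qed
  moreover have "contraction m m (\<lambda>i j. 0)" by (simp add: contraction_def)
  ultimately have ne: "?K \<noteq> {}" using tS tC by blast
  define K where "K = ?K"
  define g where "g p = f (fst p) (fst (snd p)) (snd (snd p))" for p
  have "compact K" unfolding K_def by (intro compact_Times compact_unit_sphere compact_contractions)
  moreover have "continuous_on K g" using cont continuous_on_subset unfolding g_def by blast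
  ultimately obtain p where "p \<in> K" and max: "\<And>q. q \<in> K \<Longrightarrow> g q \<le> g p"
    using continuous_attains_sup[of K g] ne unfolding K_def[symmetric] by blast
  then obtain x y W where xyW: "p = (x, y, W)" "x \<in> ?S" "y \<in> ?S" "W \<in> ?C"
    unfolding K_def by (cases p) auto
  have "f x' y' W' \<le> f x y W" if "vnorm n x' = 1" "vnorm n y' = 1" "contraction m m W'" for x' y' W'
  proof -
    \<comment> \<open>Truncation moves an arbitrary competitor into the compact set without changing
      the value of \<open>f\<close>.\<close>
    have "(?t x', ?t y', ?T W') \<in> K"
      unfolding K_def using tS[OF that(1)] tS[OF that(2)] tC[OF that(3)] by (intro SigmaI)
    from max[OF this] show ?thesis unfolding g_def xyW(1) by (simp only: fst_conv snd_conv trunc)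
  qed
  then show ?thesis using xyW by blast
qed

section \<open>Purifications and dilations\<close>

lemma index_pair_less: "k * n + b < m * n" if "k < m" "b < n" for k m n b :: nat
proof -
  have "k * n + b < Suc k * n" using that by simp
  also have "\<dots> \<le> m * n" using that by (intro mult_le_mono1) simp
  finally show ?thesis .
qed

lemma sum_lessThan_mult:
  fixes f :: "nat \<Rightarrow> 'a::comm_monoid_add"
  shows "(\<Sum>i<p * d. f i) = (\<Sum>h<p. \<Sum>r<d. f (h * d + r))"
proof (induction p)
  case (Suc p)
  have "(\<Sum>i<Suc p * d. f i) = (\<Sum>i<p * d + d. f i)" by (simp add: add.commute)
  then show ?case using Suc by (simp add: sum_lessThan_add)
qed simp

text \<open>The indices \<open>h * d\<close> are those of the basis vectors
  \<open>|h> (x) |0>\<close>.\<close>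

lemma sum_lessThan_multiples:
  fixes f :: "nat \<Rightarrow> 'a::comm_monoid_add"
  assumes "d > 0"
  shows "(\<Sum>i<p * d. if i mod d = 0 then f i else 0) = (\<Sum>h<p. f (h * d))"
  unfolding sum_lessThan_mult
proof (rule sum.cong)
  fix h
  have "(\<Sum>r<d. if (h * d + r) mod d = 0 then f (h * d + r) else 0) = (\<Sum>r<d. if r = 0 then f (h * d) else 0)"
    by (rule sum.cong) auto
  then show "(\<Sum>r<d. if (h * d + r) mod d = 0 then f (h * d + r) else 0) = f (h * d)"
    using assms by simp
qed simp

lemma kron_carrier [intro]:
  "A \<in> carrier_mat a b \<Longrightarrow> B \<in> carrier_mat c d \<Longrightarrow> kron A B \<in> carrier_mat (a * c) (b * d)"
  by (auto simp: kron_def)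

text \<open>Tensoring with \<open>|0><0|\<close> keeps only the columns of \<open>U\<close> and
  \<open>U'\<close> with index \<open>h * d\<close>, the columns of \<open>U (1 (x) |0>)\<close> and
  its analogue.\<close>

lemma index_conj_kron_ketbra:
  assumes U: "U \<in> carrier_mat n (p * d)" and U': "U' \<in> carrier_mat n' (p * d)"
    and \<rho>: "\<rho> \<in> carrier_mat p p" and d: "d > 0" and ij: "i < n" "j < n'"
  shows "(U * kron \<rho> (ketbra d 0 0) * adj U') $$ (i,j)
    = (\<Sum>h<p. \<Sum>h'<p. U $$ (i, h * d) * \<rho> $$ (h,h') * cnj (U' $$ (j, h' * d)))"
proof -
  let ?K = "kron \<rho> (ketbra d 0 0)"
  have K: "?K \<in> carrier_mat (p * d) (p * d)" using \<rho> by (intro kron_carrier) (simp_all add: ketbra_def)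
  have Kab: "?K $$ (a,b) = (if a mod d = 0 then if b mod d = 0 then \<rho> $$ (a div d, b div d) else 0 else 0)"
    if "a < p * d" "b < p * d" for a b
    using that \<rho> d by (simp add: kron_def ketbra_def)
  have UK: "(U * ?K) $$ (i,b) = (if b mod d = 0 then \<Sum>h<p. U $$ (i, h * d) * \<rho> $$ (h, b div d) else 0)"
    if b: "b < p * d" for b
  proof -
    have "(U * ?K) $$ (i,b) = (\<Sum>a<p * d. if a mod d = 0 then U $$ (i,a) * (if b mod d = 0 then \<rho> $$ (a div d, b div d) else 0) else 0)"
      unfolding index_mult_mat_sum[OF U K ij(1) b] by (intro sum.cong refl) (simp add: Kab b)
    also have "\<dots> = (\<Sum>h<p. U $$ (i, h * d) * (if b mod d = 0 then \<rho> $$ (h, b div d) else 0))"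
      using d by (auto simp: sum_lessThan_multiples intro!: sum.cong)
    finally show ?thesis by simp
  qed
  have "(U * ?K * adj U') $$ (i,j) = (\<Sum>b<p * d. (U * ?K) $$ (i,b) * adj U' $$ (b,j))"
    by (rule index_mult_mat_sum[of _ n "p * d" _ n']) (use U K U' ij in auto)
  also have "\<dots> = (\<Sum>b<p * d. if b mod d = 0 then (\<Sum>h<p. U $$ (i, h * d) * \<rho> $$ (h, b div d)) * cnj (U' $$ (j,b)) else 0)"
    using U' ij by (intro sum.cong refl) (simp add: UK)
  also have "\<dots> = (\<Sum>h'<p. (\<Sum>h<p. U $$ (i, h * d) * \<rho> $$ (h,h')) * cnj (U' $$ (j, h' * d)))"
    using d by (simp add: sum_lessThan_multiples)
  also have "\<dots> = (\<Sum>h<p. \<Sum>h'<p. U $$ (i, h * d) * \<rho> $$ (h,h') * cnj (U' $$ (j, h' * d)))"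
    unfolding sum_distrib_right by (rule sum.swap)
  finally show ?thesis .
qed

context
  fixes dA dB dK dH R :: nat
begin

text \<open>A vector \<open>x\<close> of \<open>H \<otimes> R\<close> is dilated to \<open>(U (1 \<otimes> |0>) \<otimes> 1) x\<close> in \<open>K \<otimes> B \<otimes> R\<close> and
  reshaped to a matrix from \<open>B \<otimes> R\<close> to \<open>K\<close>.\<close>

definition dilated_mat :: "complex mat \<Rightarrow> (nat \<Rightarrow> complex) \<Rightarrow> complex mat" where
  "dilated_mat U x = mat dK (dB * R) (\<lambda>(k,i). \<Sum>h<dH. U $$ (k * dB + i div R, h * dA) * x (h * R + i mod R))"

text \<open>The partial trace of \<open>|x><x|\<close> over the reference space of dimension
  \<open>R\<close>.\<close>

definition reduced_state :: "(nat \<Rightarrow> complex) \<Rightarrow> complex mat" where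
  "reduced_state x = mat dH dH (\<lambda>(h,h'). \<Sum>r<R. x (h * R + r) * cnj (x (h' * R + r)))"

text \<open>The map \<open>Y \<mapsto> tr_K (A Y A'*)\<close> on operators on \<open>H \<otimes> R\<close>, for \<open>A = U (1 \<otimes> |0>) \<otimes> 1\<close> and
  \<open>A' = U' (1 \<otimes> |0>) \<otimes> 1\<close>.\<close>

definition cross_map :: "complex mat \<Rightarrow> complex mat \<Rightarrow> (nat \<Rightarrow> nat \<Rightarrow> complex) \<Rightarrow> nat \<Rightarrow> nat \<Rightarrow> complex" where
  "cross_map U U' Y i j = (\<Sum>k<dK. \<Sum>h<dH. \<Sum>h'<dH.
     U $$ (k * dB + i div R, h * dA) * Y (h * R + i mod R) (h' * R + j mod R) * cnj (U' $$ (k * dB + j div R, h' * dA)))"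

lemma dilated_mat_carrier [simp]: "dilated_mat U x \<in> carrier_mat dK (dB * R)"
  by (simp add: dilated_mat_def)

text \<open>On a rank-one operator the double sum over \<open>H\<close> factors, leaving a matrix
  product over \<open>K\<close>; its trace norm is a fidelity by
  \<open>fidelity_eq_trace_norm\<close>.\<close>

lemma cross_map_rank_one:
  "mat (dB * R) (dB * R) (\<lambda>(i,j). cross_map U U' (\<lambda>a b. x a * cnj (y b)) i j)
     = transpose_mat (dilated_mat U x) * map_mat cnj (dilated_mat U' y)"
proof (rule eq_matI)
  fix i j
  assume "i < dim_row (transpose_mat (dilated_mat U x) * map_mat cnj (dilated_mat U' y))"
    "j < dim_col (transpose_mat (dilated_mat U x) * map_mat cnj (dilated_mat U' y))"
  then have ij: "i < dB * R" "j < dB * R" by (simp_all add: dilated_mat_def)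
  have "(transpose_mat (dilated_mat U x) * map_mat cnj (dilated_mat U' y)) $$ (i,j)
      = (\<Sum>k<dK. transpose_mat (dilated_mat U x) $$ (i,k) * map_mat cnj (dilated_mat U' y) $$ (k,j))"
    using ij by (intro index_mult_mat_sum[of _ "dB * R" dK _ "dB * R"]) (auto simp: dilated_mat_def)
  also have "\<dots> = (\<Sum>k<dK. (\<Sum>h<dH. U $$ (k * dB + i div R, h * dA) * x (h * R + i mod R)) *
      (\<Sum>h'<dH. cnj (U' $$ (k * dB + j div R, h' * dA)) * cnj (y (h' * R + j mod R))))"
    using ij by (intro sum.cong refl) (simp add: dilated_mat_def)
  also have "\<dots> = cross_map U U' (\<lambda>a b. x a * cnj (y b)) i j"
    unfolding cross_map_def sum_product by (simp add: mult_ac)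
  finally show "mat (dB * R) (dB * R) (\<lambda>(i,j). cross_map U U' (\<lambda>a b. x a * cnj (y b)) i j) $$ (i,j)
      = (transpose_mat (dilated_mat U x) * map_mat cnj (dilated_mat U' y)) $$ (i,j)"
    using ij by simp
qed (simp_all add: dilated_mat_def)

text \<open>Equality holds as functions, even for large \<open>i\<close> and \<open>j\<close>,
  because remainders modulo \<open>R > 0\<close> are always in range.\<close>

lemma cross_map_cong:
  assumes "R > 0" "\<And>a b. a < dH * R \<Longrightarrow> b < dH * R \<Longrightarrow> Y a b = Y' a b"
  shows "cross_map U U' Y = cross_map U U' Y'"
  unfolding cross_map_def using assms by (intro ext sum.cong refl) (simp add: index_pair_less)

lemma cross_map_sum: "cross_map U U' (\<lambda>a b. \<Sum>l\<in>L. F l a b) = (\<lambda>i j. \<Sum>l\<in>L. cross_map U U' (F l) i j)"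
  by (intro ext) (simp only: cross_map_def sum_distrib_left sum_distrib_right sum.swap[where A = L])

lemma cross_map_scale: "cross_map U U' (\<lambda>a b. c * Y a b) i j = c * cross_map U U' Y i j"
  unfolding cross_map_def sum_distrib_left by (simp add: mult_ac)

text \<open>Exchanging the two dilations amounts to taking adjoints, so estimates for one
  off-diagonal block carry over to the other.\<close>

lemma cross_map_adjoint: "cross_map U' U Y i j = cnj (cross_map U U' (\<lambda>a b. cnj (Y b a)) j i)"
  unfolding cross_map_def cnj_sum by (rule sum.cong[OF refl], subst sum.swap) (simp add: mult_ac)

text \<open>Tracing out the environment \<open>B\<close> and the reference space of the purification
  combine into one sum over the column index of the reshaped dilation.\<close>

lemma ptrace2_reduced_state:
  assumes U: "U \<in> carrier_mat (dK * dB) (dH * dA)" and pos: "dA > 0" "R > 0"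
  shows "ptrace2 dK dB (U * kron (reduced_state x) (ketbra dA 0 0) * adj U)
    = dilated_mat U x * adj (dilated_mat U x)"
proof (rule eq_matI)
  let ?G = "dilated_mat U x"
  have \<rho>: "reduced_state x \<in> carrier_mat dH dH" by (simp add: reduced_state_def)
  fix k k' assume "k < dim_row (?G * adj ?G)" "k' < dim_col (?G * adj ?G)"
  then have kk: "k < dK" "k' < dK" by (simp_all add: dilated_mat_def)
  have "ptrace2 dK dB (U * kron (reduced_state x) (ketbra dA 0 0) * adj U) $$ (k,k')
      = (\<Sum>b<dB. \<Sum>h<dH. \<Sum>h'<dH. U $$ (k * dB + b, h * dA) * reduced_state x $$ (h,h') * cnj (U $$ (k' * dB + b, h' * dA)))"
    using kk by (simp add: ptrace2_def) (intro sum.cong refl index_conj_kron_ketbra[OF U U \<rho> pos(1)], simp_all add: index_pair_less)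
  also have "\<dots> = (\<Sum>b<dB. \<Sum>h<dH. \<Sum>h'<dH. \<Sum>r<R. U $$ (k * dB + b, h * dA) * x (h * R + r) *
      (cnj (U $$ (k' * dB + b, h' * dA)) * cnj (x (h' * R + r))))"
    by (simp add: reduced_state_def sum_distrib_left sum_distrib_right mult_ac)
  also have "\<dots> = (\<Sum>b<dB. \<Sum>r<R. \<Sum>h<dH. \<Sum>h'<dH. U $$ (k * dB + b, h * dA) * x (h * R + r) *
      (cnj (U $$ (k' * dB + b, h' * dA)) * cnj (x (h' * R + r))))"
    by (simp only: sum.swap[where A = "{..<R}"])
  also have "\<dots> = (\<Sum>b<dB. \<Sum>r<R. ?G $$ (k, b * R + r) * cnj (?G $$ (k', b * R + r)))"
    using kk pos by (intro sum.cong refl) (simp add: dilated_mat_def index_pair_less sum_product)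
  also have "\<dots> = (\<Sum>i<dB * R. ?G $$ (k, i) * cnj (?G $$ (k', i)))"
    by (rule sum_lessThan_mult[symmetric])
  also have "\<dots> = (?G * adj ?G) $$ (k,k')"
    using kk by (subst index_mult_mat_sum[of _ dK "dB * R" _ dK]) (auto simp: dilated_mat_def)
  finally show "ptrace2 dK dB (U * kron (reduced_state x) (ketbra dA 0 0) * adj U) $$ (k,k') = (?G * adj ?G) $$ (k,k')" .
qed (simp_all add: ptrace2_def dilated_mat_def)

lemma mtrace_reduced_state: "mtrace (reduced_state x) = complex_of_real ((vnorm (dH * R) x)\<^sup>2)"
  unfolding of_real_vnorm_sq sum_lessThan_mult
  by (simp add: mtrace_def reduced_state_def mult.commute)

lemma density_reduced_state:
  assumes "vnorm (dH * R) x = 1"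
  shows "density dH (reduced_state x)"
proof -
  let ?X = "mat dH R (\<lambda>(h,r). x (h * R + r))"
  have "reduced_state x = ?X * adj ?X"
    by (rule eq_matI) (auto simp: reduced_state_def scalar_prod_def atLeast0LessThan)
  then have "psd dH (reduced_state x)" using psd_mult_adj[of ?X dH R] by simp
  then show ?thesis using assms by (simp add: density_def mtrace_reduced_state)
qed

text \<open>The square root of \<open>\<rho>\<close>, padded with zero columns up to width
  \<open>R\<close> and read as a vector, is a purification.\<close>

lemma purification_exists:
  assumes \<rho>: "density dH \<rho>" and R: "dH \<le> R" "R > 0"
  shows "\<exists>x. vnorm (dH * R) x = 1 \<and> reduced_state x = \<rho>"
proof -
  define S where "S = msqrt \<rho>"
  have "psd dH S" and SS: "S * S = \<rho>" using psd_msqrt[of dH \<rho>] \<rho> by (auto simp: S_def density_def)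
  then have S: "S \<in> carrier_mat dH dH" "adj S = S" by (auto simp: psd_def)
  define x where "x a = (if a mod R < dH then S $$ (a div R, a mod R) else 0)" for a
  have x: "x (h * R + r) = (if r < dH then S $$ (h,r) else 0)" if "r < R" for h r
    using that R by (simp add: x_def)
  have red: "reduced_state x = \<rho>"
  proof (rule eq_matI)
    fix h h' assume "h < dim_row \<rho>" "h' < dim_col \<rho>"
    then have hh: "h < dH" "h' < dH" using S by (auto simp flip: SS)
    obtain t where t: "R = dH + t" using R(1) le_Suc_ex by blast
    have "reduced_state x $$ (h,h') = (\<Sum>r<R. if r < dH then S $$ (h,r) * cnj (S $$ (h',r)) else 0)"
      using hh by (simp add: reduced_state_def) (intro sum.cong refl, simp add: x)
    also have "\<dots> = (\<Sum>r<dH. S $$ (h,r) * cnj (S $$ (h',r)))"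
      unfolding t by (simp add: sum_lessThan_add)
    also have "\<dots> = (S * adj S) $$ (h,h')"
      using hh S(1) by (subst index_mult_mat_sum[of _ dH dH _ dH]) auto
    finally show "reduced_state x $$ (h,h') = \<rho> $$ (h,h')" using S SS by simp
  qed (use S in \<open>auto simp: reduced_state_def simp flip: SS\<close>)
  then have "complex_of_real ((vnorm (dH * R) x)\<^sup>2) = 1"
    using \<rho> mtrace_reduced_state[of x] by (simp add: density_def)
  then have "vnorm (dH * R) x = 1" by (intro vnorm_eq_1) (simp only: of_real_eq_1_iff)
  then show ?thesis using red by blast
qed

end

text \<open>The real part of a polynomial in finitely many coordinates and their conjugates.\<close>

lemma continuous_hs_inner_cross_map:
  "continuous_on UNIV (\<lambda>p. Re (hs_inner m m (snd (snd p))
     (cross_map dA dB dK dH R U U' (\<lambda>a b. fst p a * cnj (fst (snd p) b)))))"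
  unfolding hs_inner_def cross_map_def
  by (intro continuous_intros continuous_on_product_then_coordinatewise[OF continuous_on_product_then_coordinatewise]
    continuous_on_product_then_coordinatewise)

text \<open>A vector of norm 0 vanishes below \<open>n\<close>, so there any unit vector serves as
  \<open>e\<close>; for other vectors \<open>e\<close> is the normalized vector.\<close>

lemma vnorm_normalize:
  assumes "n > 0"
  shows "\<exists>e. vnorm n e = 1 \<and> (\<forall>a<n. x a = complex_of_real (vnorm n x) * e a)"
proof (cases "vnorm n x = 0")
  case True
  have "(vnorm n (\<lambda>k. if k = 0 then 1 else 0))\<^sup>2 = 1"
    using assms by (simp add: vnorm_sq if_distrib[of cmod] if_distrib[of "\<lambda>x. x\<^sup>2"] cong: if_cong)
  moreover have "x a = 0" if "a < n" for a
    using True that L2_set_eq_0_iff[of "{..<n}" "\<lambda>i. cmod (x i)"] by (simp add: vnorm_def)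
  ultimately show ?thesis using True vnorm_eq_1 by (metis mult_zero_left of_real_0)
next
  case False
  let ?e = "\<lambda>a. complex_of_real (inverse (vnorm n x)) * x a"
  have "(vnorm n ?e)\<^sup>2 = (inverse (vnorm n x))\<^sup>2 * (vnorm n x)\<^sup>2"
    unfolding vnorm_sq[of n ?e] vnorm_sq[of n x, symmetric] norm_mult power_mult_distrib
    by (simp add: vnorm_sq sum_distrib_left norm_inverse)
  also have "\<dots> = 1" using False by (simp flip: power_mult_distrib)
  finally have "vnorm n ?e = 1" by (rule vnorm_eq_1)
  then show ?thesis using False by (intro exI[of _ ?e]) simp
qed

text \<open>Cauchy-Schwarz in the real plane for the norms of the halves, taken crosswise; the gap
  between the squared sides is a perfect square.\<close>

lemma cross_products_le_vnorm:
  "vnorm n x * vnorm n (\<lambda>i. y (n + i)) + vnorm n (\<lambda>i. x (n + i)) * vnorm n y \<le> vnorm (n + n) x * vnorm (n + n) y"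
proof (rule power2_le_imp_le)
  have "(a * d + b * c)\<^sup>2 \<le> (a\<^sup>2 + b\<^sup>2) * (c\<^sup>2 + d\<^sup>2)" for a b c d :: real
  proof -
    have "(a\<^sup>2 + b\<^sup>2) * (c\<^sup>2 + d\<^sup>2) - (a * d + b * c)\<^sup>2 = (a * c - b * d)\<^sup>2"
      by (simp add: power2_eq_square algebra_simps)
    then show ?thesis by (metis diff_ge_0_iff_ge zero_le_power2)
  qed
  then show "(vnorm n x * vnorm n (\<lambda>i. y (n + i)) + vnorm n (\<lambda>i. x (n + i)) * vnorm n y)\<^sup>2
      \<le> (vnorm (n + n) x * vnorm (n + n) y)\<^sup>2"
    by (simp add: power_mult_distrib vnorm_sq_add)
qed simp

section \<open>The controlled channels\<close>

lemma div_mod_less_double: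
  fixes i n :: nat
  assumes "i < n + n"
  shows "i div n = (if i < n then 0 else 1)" "i mod n = (if i < n then i else i - n)"
proof -
  have "n > 0" using assms by simp
  show "i div n = (if i < n then 0 else 1)"
  proof (cases "i < n")
    case False
    then show ?thesis using assms \<open>n > 0\<close> le_div_geq[of n i] by simp
  qed simp
  show "i mod n = (if i < n then i else i - n)"
    using assms le_mod_geq[of n i] by simp
qed

lemma index_controlled:
  assumes U: "U1 \<in> carrier_mat n m" "U2 \<in> carrier_mat n m" and ij: "i < n + n" "j < m + m"
  shows "(kron (ketbra 2 0 0) U1 + kron (ketbra 2 1 1) U2) $$ (i,j)
    = (if i < n \<and> j < m then U1 $$ (i,j) else if n \<le> i \<and> m \<le> j then U2 $$ (i - n, j - m) else 0)"
  using U ij by (auto simp: kron_def ketbra_def div_mod_less_double)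

lemma kron_pauliZ_one:
  "kron pauliZ (1\<^sub>m n) = mat_diag (n + n) (\<lambda>i. if i < n then 1 else - 1)"
proof (rule eq_matI)
  fix i j
  assume "i < dim_row (mat_diag (n + n) (\<lambda>i. if i < n then 1 else - 1 :: complex))"
    "j < dim_col (mat_diag (n + n) (\<lambda>i. if i < n then 1 else - 1 :: complex))"
  then have ij: "i < n + n" "j < n + n" by simp_all
  then have d: "i div n < 2" "j div n < 2" "i mod n < n" "j mod n < n"
    by (auto simp: div_mod_less_double)
  have "kron pauliZ (1\<^sub>m n) $$ (i,j) = pauliZ $$ (i div n, j div n) * 1\<^sub>m n $$ (i mod n, j mod n)"
    using ij by (simp add: kron_def pauliZ_def)
  also have "\<dots> = (if i = j then if i < n then 1 else - 1 else 0)"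
    using d ij by (auto simp: pauliZ_def div_mod_less_double split: if_splits)
  finally show "kron pauliZ (1\<^sub>m n) $$ (i,j) = mat_diag (n + n) (\<lambda>i. if i < n then 1 else - 1) $$ (i,j)"
    using ij by (simp add: mat_diag_def)
qed (simp_all add: kron_def pauliZ_def)

lemma index_diag_conj:
  assumes "M \<in> carrier_mat n n" "i < n" "j < n"
  shows "(mat_diag n z * M * mat_diag n z) $$ (i,j) = z i * M $$ (i,j) * z j"
proof -
  have "mat_diag n z * M * mat_diag n z = mat n n (\<lambda>(i,j). (mat_diag n z * M) $$ (i,j) * z j)"
    using assms(1) by (intro mat_diag_mult_right) auto
  moreover have "mat_diag n z * M = mat n n (\<lambda>(i,j). z i * M $$ (i,j))"
    using assms(1) by (rule mat_diag_mult_left)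
  ultimately show ?thesis using assms by simp
qed

context
  fixes dA dB dK dH :: nat and U1 U2 V ZQ :: "complex mat" and C1 C2 :: "complex mat \<Rightarrow> complex mat"
  assumes pos: "dA > 0" "dB > 0" "dK > 0" "dH > 0"
    and U1: "U1 \<in> carrier_mat (dK * dB) (dH * dA)" and U2: "U2 \<in> carrier_mat (dK * dB) (dH * dA)"
    and V_def: "V = kron (ketbra 2 0 0) U1 + kron (ketbra 2 1 1) U2"
    and ZQ_def: "ZQ = kron pauliZ (1\<^sub>m (dK*dB))"
    and C1_def: "\<And>\<rho>. C1 \<rho> = ptrace_mid 2 dK dB (V * kron \<rho> (ketbra dA 0 0) * adj V)"
    and C2_def: "\<And>\<rho>. C2 \<rho> = ptrace_mid 2 dK dB (ZQ * V * kron \<rho> (ketbra dA 0 0) * adj V * ZQ)"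
begin

lemma V_carrier: "V \<in> carrier_mat (dK * dB + dK * dB) (dH * dA + dH * dA)"
  unfolding V_def using kron_carrier[of "ketbra 2 0 0" 2 2, OF _ U1] kron_carrier[of "ketbra 2 1 1" 2 2, OF _ U2]
  by (simp add: ketbra_def mult_2)

lemma index_V:
  assumes "i < dK * dB" "j < dH * dA"
  shows "V $$ (i,j) = U1 $$ (i,j)" "V $$ (i, dH * dA + j) = 0" "V $$ (dK * dB + i, j) = 0"
    "V $$ (dK * dB + i, dH * dA + j) = U2 $$ (i,j)"
  unfolding V_def using assms by (simp_all add: index_controlled[OF U1 U2] del: One_nat_def)

text \<open>\<open>V\<close> is block diagonal in the control qubit, so each off-diagonal block of
  the result comes from the same block of \<open>\<rho>\<close>.\<close>

lemma index_V_conj: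
  assumes \<rho>: "\<rho> \<in> carrier_mat (2 * dH) (2 * dH)" and ij: "i < dK * dB" "j < dK * dB"
  defines "M \<equiv> V * kron \<rho> (ketbra dA 0 0) * adj V"
  shows "M $$ (i, dK * dB + j) = (\<Sum>h<dH. \<Sum>h'<dH. U1 $$ (i, h * dA) * \<rho> $$ (h, dH + h') * cnj (U2 $$ (j, h' * dA)))"
    and "M $$ (dK * dB + i, j) = (\<Sum>h<dH. \<Sum>h'<dH. U2 $$ (i, h * dA) * \<rho> $$ (dH + h, h') * cnj (U1 $$ (j, h' * dA)))"
proof -
  \<comment> \<open>Grouping the control qubit with \<open>H\<close> in the column index makes
    \<open>index_conj_kron_ketbra\<close> applicable with \<open>p = dH + dH\<close>.\<close>
  have V: "V \<in> carrier_mat (dK * dB + dK * dB) ((dH + dH) * dA)"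
    using V_carrier by (simp add: add_mult_distrib)
  have \<rho>: "\<rho> \<in> carrier_mat (dH + dH) (dH + dH)" using \<rho> by (simp add: mult_2)
  have M: "M $$ (a,b) = (\<Sum>h<dH+dH. \<Sum>h'<dH+dH. V $$ (a, h * dA) * \<rho> $$ (h,h') * cnj (V $$ (b, h' * dA)))"
    if "a < dK * dB + dK * dB" "b < dK * dB + dK * dB" for a b
    unfolding M_def by (rule index_conj_kron_ketbra[OF V V \<rho> pos(1) that])
  show "M $$ (i, dK * dB + j) = (\<Sum>h<dH. \<Sum>h'<dH. U1 $$ (i, h * dA) * \<rho> $$ (h, dH + h') * cnj (U2 $$ (j, h' * dA)))"
    using ij pos by (subst M) (simp_all add: sum_lessThan_add index_V add_mult_distrib)
  show "M $$ (dK * dB + i, j) = (\<Sum>h<dH. \<Sum>h'<dH. U2 $$ (i, h * dA) * \<rho> $$ (dH + h, h') * cnj (U1 $$ (j, h' * dA)))"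
    using ij pos by (subst M) (simp_all add: sum_lessThan_add index_V add_mult_distrib)
qed

text \<open>Conjugation by \<open>ZQ\<close> gives an entry the product of the signs of its row and
  column sectors, so the difference cancels within a sector and doubles across sectors.\<close>

lemma index_channel_difference:
  assumes \<rho>: "\<rho> \<in> carrier_mat (2 * dH) (2 * dH)" and b: "b < dB" "b' < dB"
  defines "D \<equiv> C1 \<rho> - C2 \<rho>"
  shows "D $$ (b, b') = 0" "D $$ (dB + b, dB + b') = 0"
    and "D $$ (b, dB + b') = 2 * (\<Sum>k<dK. \<Sum>h<dH. \<Sum>h'<dH.
      U1 $$ (k * dB + b, h * dA) * \<rho> $$ (h, dH + h') * cnj (U2 $$ (k * dB + b', h' * dA)))"
    and "D $$ (dB + b, b') = 2 * (\<Sum>k<dK. \<Sum>h<dH. \<Sum>h'<dH.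
      U2 $$ (k * dB + b, h * dA) * \<rho> $$ (dH + h, h') * cnj (U1 $$ (k * dB + b', h' * dA)))"
proof -
  let ?n = "dK * dB"
  define M where "M = V * kron \<rho> (ketbra dA 0 0) * adj V"
  define N where "N = ZQ * V * kron \<rho> (ketbra dA 0 0) * adj V * ZQ"
  have K: "kron \<rho> (ketbra dA 0 0) \<in> carrier_mat (dH * dA + dH * dA) (dH * dA + dH * dA)"
    using kron_carrier[OF \<rho>, of "ketbra dA 0 0" dA dA] by (simp add: ketbra_def mult_2 add_mult_distrib)
  have M: "M \<in> carrier_mat (?n + ?n) (?n + ?n)"
    unfolding M_def using V_carrier K by auto
  have ZQ: "ZQ \<in> carrier_mat (?n + ?n) (?n + ?n)" unfolding ZQ_def kron_pauliZ_one by simp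
  have "N = ZQ * M * ZQ"
    unfolding N_def M_def using ZQ V_carrier K mult_carrier_mat[OF V_carrier K]
    by (simp add: assoc_mult_mat[OF ZQ V_carrier K] assoc_mult_mat[OF ZQ _ adj_carrier[OF V_carrier]])
  then have N: "N $$ (i,j) = (if i < ?n then 1 else - 1) * M $$ (i,j) * (if j < ?n then 1 else - 1)"
    if "i < ?n + ?n" "j < ?n + ?n" for i j
    unfolding ZQ_def kron_pauliZ_one using index_diag_conj[OF M that] by simp
  have D: "D $$ (i,j) = (\<Sum>k<dK. M $$ ((i div dB) * ?n + k * dB + i mod dB, (j div dB) * ?n + k * dB + j mod dB)
      - N $$ ((i div dB) * ?n + k * dB + i mod dB, (j div dB) * ?n + k * dB + j mod dB))"
    if "i < 2 * dB" "j < 2 * dB" for i j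
    using that unfolding D_def C1_def C2_def M_def[symmetric] N_def[symmetric]
    by (simp add: ptrace_mid_def sum_subtractf)
  have lt: "k * dB + c < ?n" if "k < dK" "c < dB" for k c using that by (rule index_pair_less)
  have lt2: "k * dB + c < ?n + ?n" "?n + (k * dB + c) < ?n + ?n" if "k < dK" "c < dB" for k c
    using lt[OF that] by simp_all
  show "D $$ (b, b') = 0"
    using b lt lt2 by (subst D) (auto simp: N intro!: sum.neutral)
  show "D $$ (dB + b, dB + b') = 0"
    using b lt lt2 pos by (subst D) (auto simp: N add.assoc intro!: sum.neutral)
  show "D $$ (b, dB + b') = 2 * (\<Sum>k<dK. \<Sum>h<dH. \<Sum>h'<dH.
      U1 $$ (k * dB + b, h * dA) * \<rho> $$ (h, dH + h') * cnj (U2 $$ (k * dB + b', h' * dA)))"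
    using b lt lt2 pos unfolding sum_distrib_left[of _ _ "{..<dK}"]
    by (subst D) (auto simp: N add.assoc index_V_conj[OF \<rho>, folded M_def] intro!: sum.cong)
  show "D $$ (dB + b, b') = 2 * (\<Sum>k<dK. \<Sum>h<dH. \<Sum>h'<dH.
      U2 $$ (k * dB + b, h * dA) * \<rho> $$ (dH + h, h') * cnj (U1 $$ (k * dB + b', h' * dA)))"
    using b lt lt2 pos unfolding sum_distrib_left[of _ _ "{..<dK}"]
    by (subst D) (auto simp: N add.assoc index_V_conj[OF \<rho>, folded M_def] intro!: sum.cong)
qed

text \<open>The reference space of the diamond norm is a copy of \<open>Q (x) H\<close>, hence the
  dimension \<open>2 * dH\<close>. The control qubit is the leading tensor factor, so its sectors
  are the two halves of each index range.\<close>

lemma index_tensor_id_difference: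
  assumes ij: "i < dB * (2 * dH)" "j < dB * (2 * dH)"
  defines "T \<equiv> tensor_id (2 * dH) (2 * dB) (\<lambda>X. C1 X - C2 X)"
    and "m \<equiv> dB * (2 * dH)" and "n \<equiv> dH * (2 * dH)"
  shows "T X $$ (i,j) = 0" "T X $$ (m + i, m + j) = 0"
    and "T X $$ (i, m + j) = 2 * cross_map dA dB dK dH (2 * dH) U1 U2 (\<lambda>a b. X $$ (a, n + b)) i j"
    and "T X $$ (m + i, j) = 2 * cross_map dA dB dK dH (2 * dH) U2 U1 (\<lambda>a b. X $$ (n + a, b)) i j"
proof -
  define R where "R = 2 * dH"
  have R: "R > 0" using pos by (simp add: R_def)
  have d: "i div R < dB" "j div R < dB" using ij by (auto simp: R_def less_mult_imp_div_less)
  have s: "(m + k) div R = dB + k div R" "(m + k) mod R = k mod R" for k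
    using R by (simp_all add: m_def R_def)
  have n: "n = dH * R" by (simp add: n_def R_def)
  have lt: "i < m" "j < m" using ij by (simp_all add: m_def)
  \<comment> \<open>\<open>Y k l\<close> is the operator on \<open>Q (x) H\<close> that
    \<open>tensor_id\<close> feeds to the channels when computing entry
    \<open>(k,l)\<close>.\<close>
  define Y where "Y k l = mat R R (\<lambda>(p,q). X $$ (p * R + k mod R, q * R + l mod R))" for k l
  have Y: "Y k l \<in> carrier_mat (2 * dH) (2 * dH)" for k l by (simp add: Y_def R_def)
  have T: "T X $$ (k,l) = (C1 (Y k l) - C2 (Y k l)) $$ (k div R, l div R)" if "k < m + m" "l < m + m" for k l
  proof -
    have "2 * dB * (2 * dH) = m + m" by (simp add: m_def)
    then show ?thesis using that unfolding T_def tensor_id_def R_def Y_def by simp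
  qed
  have shift: "(dH + h) * R + c = n + (h * R + c)" for h c
    by (simp add: n add_mult_distrib add.assoc)
  have Y_eq: "Y i (m + j) $$ (h, dH + h') = X $$ (h * R + i mod R, n + (h' * R + j mod R))"
    "Y (m + i) j $$ (dH + h, h') = X $$ (n + (h * R + i mod R), h' * R + j mod R)" if "h < dH" "h' < dH" for h h'
  proof -
    have "h < R" "h' < R" "dH + h < R" "dH + h' < R" using that by (simp_all add: R_def)
    then show "Y i (m + j) $$ (h, dH + h') = X $$ (h * R + i mod R, n + (h' * R + j mod R))"
      "Y (m + i) j $$ (dH + h, h') = X $$ (n + (h * R + i mod R), h' * R + j mod R)"
      by (simp_all add: Y_def s shift)
  qed
  show "T X $$ (i,j) = 0" "T X $$ (m + i, m + j) = 0"
    using lt index_channel_difference(1,2)[OF Y d] by (simp_all add: T s)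
  have "T X $$ (i, m + j) = (C1 (Y i (m + j)) - C2 (Y i (m + j))) $$ (i div R, dB + j div R)"
    using lt T[of i "m + j"] by (simp add: s)
  also have "\<dots> = 2 * cross_map dA dB dK dH (2 * dH) U1 U2 (\<lambda>a b. X $$ (a, n + b)) i j"
    unfolding index_channel_difference(3)[OF Y d] cross_map_def R_def[symmetric] by (simp add: Y_eq)
  finally show "T X $$ (i, m + j) = 2 * cross_map dA dB dK dH (2 * dH) U1 U2 (\<lambda>a b. X $$ (a, n + b)) i j" .
  have "T X $$ (m + i, j) = (C1 (Y (m + i) j) - C2 (Y (m + i) j)) $$ (dB + i div R, j div R)"
    using lt T[of "m + i" j] by (simp add: s)
  also have "\<dots> = 2 * cross_map dA dB dK dH (2 * dH) U2 U1 (\<lambda>a b. X $$ (n + a, b)) i j"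
    unfolding index_channel_difference(4)[OF Y d] cross_map_def R_def[symmetric] by (simp add: Y_eq)
  finally show "T X $$ (m + i, j) = 2 * cross_map dA dB dK dH (2 * dH) U2 U1 (\<lambda>a b. X $$ (n + a, b)) i j" .
qed

text \<open>The pairing splits over four blocks, of which the two diagonal ones vanish.\<close>

lemma hs_inner_tensor_id_difference:
  defines "T \<equiv> tensor_id (2 * dH) (2 * dB) (\<lambda>X. C1 X - C2 X)"
    and "m \<equiv> dB * (2 * dH)" and "n \<equiv> dH * (2 * dH)"
  shows "hs_inner (m + m) (m + m) W (\<lambda>i j. T X $$ (i,j))
    = 2 * hs_inner m m (\<lambda>i j. W i (m + j)) (cross_map dA dB dK dH (2 * dH) U1 U2 (\<lambda>a b. X $$ (a, n + b)))
    + 2 * hs_inner m m (\<lambda>i j. W (m + i) j) (cross_map dA dB dK dH (2 * dH) U2 U1 (\<lambda>a b. X $$ (n + a, b)))"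
proof -
  note T = index_tensor_id_difference[folded T_def m_def n_def]
  have "(\<Sum>i<m. \<Sum>j<m. cnj (W i j) * T X $$ (i,j)) = 0"
    "(\<Sum>i<m. \<Sum>j<m. cnj (W (m + i) (m + j)) * T X $$ (m + i,m + j)) = 0"
    by (intro sum.neutral ballI; simp add: T)+
  moreover have "(\<Sum>i<m. \<Sum>j<m. cnj (W i (m + j)) * T X $$ (i,m + j))
    = 2 * hs_inner m m (\<lambda>i j. W i (m + j)) (cross_map dA dB dK dH (2 * dH) U1 U2 (\<lambda>a b. X $$ (a, n + b)))"
    unfolding hs_inner_def sum_distrib_left by (intro sum.cong refl) (simp add: T)
  moreover have "(\<Sum>i<m. \<Sum>j<m. cnj (W (m + i) j) * T X $$ (m + i,j))
    = 2 * hs_inner m m (\<lambda>i j. W (m + i) j) (cross_map dA dB dK dH (2 * dH) U2 U1 (\<lambda>a b. X $$ (n + a, b)))"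
    unfolding hs_inner_def sum_distrib_left by (intro sum.cong refl) (simp add: T)
  ultimately show ?thesis
    unfolding hs_inner_def[of "m + m"] sum_lessThan_add sum.distrib by simp
qed

end

text \<open>The cross map is \<open>1/2 (C1 - C2)\<close> between the two sectors of the control qubit, so the maximum \<open>s\<close>
  below is simultaneously the largest fidelity and half of the diamond norm.\<close>

lemma cross_map_maximum:
  fixes dA dB dK dH R :: nat and U1 U2 :: "complex mat"
  assumes pos: "dH > 0" "R > 0"
  defines "m \<equiv> dB * R" and "n \<equiv> dH * R"
    and "\<Phi> \<equiv> \<lambda>x y. cross_map dA dB dK dH R U1 U2 (\<lambda>a b. x a * cnj (y b))"
  shows "\<exists>s x y W. vnorm n x = 1 \<and> vnorm n y = 1 \<and> contraction m m W \<and>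
    s = Re (hs_inner m m W (\<Phi> x y)) \<and> s = trace_norm (mat m m (\<lambda>(i,j). \<Phi> x y i j)) \<and>
    (\<forall>x y. vnorm n x = 1 \<longrightarrow> vnorm n y = 1 \<longrightarrow> trace_norm (mat m m (\<lambda>(i,j). \<Phi> x y i j)) \<le> s) \<and>
    (\<forall>x y W. contraction m m W \<longrightarrow> cmod (hs_inner m m W (\<Phi> x y)) \<le> s * (vnorm n x * vnorm n y))"
proof -
  have n0: "n > 0" using pos by (simp add: n_def)
  have \<Phi>_cong: "\<Phi> x y = \<Phi> x' y'" if "\<And>a. a < n \<Longrightarrow> x a = x' a" "\<And>a. a < n \<Longrightarrow> y a = y' a" for x y x' y'
    unfolding \<Phi>_def by (rule cross_map_cong) (use pos that in \<open>simp_all add: n_def\<close>)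
  define f where "f x y W = Re (hs_inner m m W (\<Phi> x y))" for x y W
  have "\<exists>x y W. vnorm n x = 1 \<and> vnorm n y = 1 \<and> contraction m m W \<and>
    (\<forall>x' y' W'. vnorm n x' = 1 \<longrightarrow> vnorm n y' = 1 \<longrightarrow> contraction m m W' \<longrightarrow> f x' y' W' \<le> f x y W)"
  proof (rule maximum_over_unit_vectors_and_contractions[OF n0])
    show "continuous_on UNIV (\<lambda>p. f (fst p) (fst (snd p)) (snd (snd p)))"
      unfolding f_def \<Phi>_def by (rule continuous_hs_inner_cross_map)
    show "f (\<lambda>i. if i < n then x i else 0) (\<lambda>i. if i < n then y i else 0) (\<lambda>i j. if i < m \<and> j < m then W i j else 0)
        = f x y W" for x y W
      unfolding f_def by (subst \<Phi>_cong[of _ x _ y]) (auto intro!: arg_cong[of _ _ Re] hs_inner_cong)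
  qed
  then obtain x y W where xy: "vnorm n x = 1" "vnorm n y = 1" and W: "contraction m m W"
    and max: "\<And>x' y' W'. vnorm n x' = 1 \<Longrightarrow> vnorm n y' = 1 \<Longrightarrow> contraction m m W' \<Longrightarrow> f x' y' W' \<le> f x y W"
    by blast
  define s where "s = f x y W"
  let ?M = "\<lambda>x y. mat m m (\<lambda>(i,j). \<Phi> x y i j)"
  have M: "?M x y \<in> carrier_mat m m" for x y by simp
  have hM: "hs_inner m m W (\<lambda>i j. ?M x y $$ (i,j)) = hs_inner m m W (\<Phi> x y)" for W x y
    by (rule hs_inner_cong) simp_all
  \<comment> \<open>Each pair of unit vectors, taken with its own optimal contraction, is a
    competitor for the maximum.\<close>
  have le: "trace_norm (?M x' y') \<le> s" if u: "vnorm n x' = 1" "vnorm n y' = 1" for x' y'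
  proof -
    obtain W' where "contraction m m W'" "hs_inner m m W' (\<Phi> x' y') = complex_of_real (trace_norm (?M x' y'))"
      using trace_norm_attained[OF M[of x' y']] unfolding hM by blast
    then show ?thesis using max[OF u] unfolding s_def f_def by fastforce
  qed
  have "s \<le> cmod (hs_inner m m W (\<Phi> x y))" unfolding s_def f_def by (rule complex_Re_le_cmod)
  also have "\<dots> \<le> trace_norm (?M x y)" using hs_inner_le_trace_norm[OF M W, of x y] unfolding hM .
  finally have "s = trace_norm (?M x y)" using le[OF xy] by simp
  \<comment> \<open>The bound extends from unit vectors by homogeneity; passing through the trace
    norm replaces the real part by the modulus.\<close>
  moreover have "cmod (hs_inner m m W' (\<Phi> x' y')) \<le> s * (vnorm n x' * vnorm n y')" if W': "contraction m m W'" for x' y' W'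
  proof -
    obtain e where e: "vnorm n e = 1" "\<And>a. a < n \<Longrightarrow> x' a = complex_of_real (vnorm n x') * e a"
      using vnorm_normalize[OF n0, of x'] by blast
    obtain g where g: "vnorm n g = 1" "\<And>a. a < n \<Longrightarrow> y' a = complex_of_real (vnorm n y') * g a"
      using vnorm_normalize[OF n0, of y'] by blast
    let ?c = "complex_of_real (vnorm n x' * vnorm n y')"
    have "\<Phi> x' y' = \<Phi> (\<lambda>a. complex_of_real (vnorm n x') * e a) (\<lambda>a. complex_of_real (vnorm n y') * g a)"
      by (rule \<Phi>_cong) (use e g in auto)
    also have "\<dots> = cross_map dA dB dK dH R U1 U2 (\<lambda>a b. ?c * (e a * cnj (g b)))"
      unfolding \<Phi>_def by (intro arg_cong[of _ _ "cross_map dA dB dK dH R U1 U2"] ext) simp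
    also have "\<dots> = (\<lambda>i j. ?c * \<Phi> e g i j)"
      unfolding \<Phi>_def by (intro ext cross_map_scale)
    finally have "hs_inner m m W' (\<Phi> x' y') = ?c * hs_inner m m W' (\<Phi> e g)"
      by (simp add: hs_inner_def sum_distrib_left mult_ac)
    then have "cmod (hs_inner m m W' (\<Phi> x' y')) = vnorm n x' * vnorm n y' * cmod (hs_inner m m W' (\<Phi> e g))"
      by (simp add: norm_mult)
    also have "\<dots> \<le> vnorm n x' * vnorm n y' * s"
      using hs_inner_le_trace_norm[OF M W', of e g] le[OF e(1) g(1)] unfolding hM
      by (intro mult_left_mono) simp_all
    finally show ?thesis by (simp add: mult.commute)
  qed
  ultimately show ?thesis using xy W le unfolding s_def f_def by blast
qed

section \<open>Half the diamond norm as a maximal output fidelity\<close>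

theorem theorem5p4:
  fixes dH dA dK dB :: nat and U1 U2 :: "complex mat"
    and Q1 Q2 :: "complex mat \<Rightarrow> complex mat"
    and V ZQ :: "complex mat" and C1 C2 :: "complex mat \<Rightarrow> complex mat"
  assumes "dH > 0" "dA > 0" "dK > 0" "dB > 0"
    and U1: "unitary_mat (dK*dB) (dH*dA) U1"
    and U2: "unitary_mat (dK*dB) (dH*dA) U2"
    and Q1_def: "\<And>\<rho>. Q1 \<rho> = ptrace2 dK dB (U1 * kron \<rho> (ketbra dA 0 0) * adj U1)"
    and Q2_def: "\<And>\<rho>. Q2 \<rho> = ptrace2 dK dB (U2 * kron \<rho> (ketbra dA 0 0) * adj U2)"
    and V_def: "V = kron (ketbra 2 0 0) U1 + kron (ketbra 2 1 1) U2"
    and ZQ_def: "ZQ = kron pauliZ (1\<^sub>m (dK*dB))"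
    and C1_def: "\<And>\<rho>. C1 \<rho> = ptrace_mid 2 dK dB (V * kron \<rho> (ketbra dA 0 0) * adj V)"
    and C2_def: "\<And>\<rho>. C2 \<rho> = ptrace_mid 2 dK dB (ZQ * V * kron \<rho> (ketbra dA 0 0) * adj V * ZQ)"
  shows "(\<exists>\<rho>0 \<sigma>0. density dH \<rho>0 \<and> density dH \<sigma>0 \<and>
            diamond_norm (2*dH) (2*dB) (\<lambda>X. C1 X - C2 X) / 2 = fidelity (Q1 \<rho>0) (Q2 \<sigma>0)) \<and>
         (\<forall>\<rho> \<sigma>. density dH \<rho> \<and> density dH \<sigma> \<longrightarrow>
            fidelity (Q1 \<rho>) (Q2 \<sigma>) \<le> diamond_norm (2*dH) (2*dB) (\<lambda>X. C1 X - C2 X) / 2)"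
proof -
  have U: "U1 \<in> carrier_mat (dK*dB) (dH*dA)" "U2 \<in> carrier_mat (dK*dB) (dH*dA)"
    using U1 U2 by (auto simp: unitary_mat_def)
  \<comment> \<open>The reference dimension is at least \<open>dH\<close>, so every density operator
    has a purification. Below, \<open>n\<close> and \<open>m\<close> are the dimensions of one
    control sector of the input and output, reference included.\<close>
  define R where "R = 2 * dH"
  define m where "m = dB * (2 * dH)"
  define n where "n = dH * (2 * dH)"
  have R: "R > 0" "dH \<le> R" using assms(1) by (simp_all add: R_def)
  have dims: "2 * dH * (2 * dH) = n + n" "2 * dB * (2 * dH) = m + m" by (simp_all add: n_def m_def)
  define T where "T = tensor_id (2 * dH) (2 * dB) (\<lambda>X. C1 X - C2 X)"
  define \<Psi> where "\<Psi> = cross_map dA dB dK dH (2 * dH) U1 U2"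
  define \<Psi>' where "\<Psi>' = cross_map dA dB dK dH (2 * dH) U2 U1"
  define \<Phi> where "\<Phi> x y = \<Psi> (\<lambda>a b. x a * cnj (y b))" for x y
  have hsT: "hs_inner (m + m) (m + m) W (\<lambda>i j. T X $$ (i,j))
    = 2 * hs_inner m m (\<lambda>i j. W i (m + j)) (\<Psi> (\<lambda>a b. X $$ (a, n + b)))
    + 2 * hs_inner m m (\<lambda>i j. W (m + i) j) (\<Psi>' (\<lambda>a b. X $$ (n + a, b)))" for W X
    unfolding T_def \<Psi>_def \<Psi>'_def m_def n_def
    using hs_inner_tensor_id_difference[OF assms(2,4,3,1) U V_def ZQ_def C1_def C2_def] .
  have T: "T X \<in> carrier_mat (m + m) (m + m)" for X
    unfolding T_def tensor_id_def dims by simp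
  obtain s x y W where xy: "vnorm n x = 1" "vnorm n y = 1" and W: "contraction m m W"
    and s: "s = Re (hs_inner m m W (\<Phi> x y))" "s = trace_norm (mat m m (\<lambda>(i,j). \<Phi> x y i j))"
    and max: "\<And>x y. vnorm n x = 1 \<Longrightarrow> vnorm n y = 1 \<Longrightarrow> trace_norm (mat m m (\<lambda>(i,j). \<Phi> x y i j)) \<le> s"
    and bound: "\<And>x y W. contraction m m W \<Longrightarrow> cmod (hs_inner m m W (\<Phi> x y)) \<le> s * (vnorm n x * vnorm n y)"
    using cross_map_maximum[OF assms(1) R(1), where dA = dA and dB = dB and dK = dK and ?U1.0 = U1 and ?U2.0 = U2]
    unfolding R_def m_def[symmetric] n_def[symmetric] \<Phi>_def \<Psi>_def by auto
  have s0: "s \<ge> 0" unfolding s(2) by (rule trace_norm_nonneg)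

  have bound': "cmod (hs_inner m m W (\<Psi>' (\<lambda>a b. x a * cnj (y b)))) \<le> s * (vnorm n x * vnorm n y)"
    if W: "contraction m m W" for x y W
  proof -
    have "\<Psi>' (\<lambda>a b. x a * cnj (y b)) i j = cnj (\<Phi> y x j i)" for i j
      unfolding \<Psi>'_def \<Phi>_def \<Psi>_def by (subst cross_map_adjoint) (simp add: mult.commute)
    then have "hs_inner m m W (\<Psi>' (\<lambda>a b. x a * cnj (y b))) = cnj (hs_inner m m (\<lambda>i j. cnj (W j i)) (\<Phi> y x))"
      unfolding hs_inner_def by (subst sum.swap) simp
    then show ?thesis
      using bound[OF contraction_adjoint[OF W], of y x] by (simp add: mult.commute)
  qed

  \<comment> \<open>This links the two sides of the theorem: output fidelities are trace norms of
    the cross map on rank-one operators.\<close>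
  have fid: "fidelity (Q1 (reduced_state dH (2*dH) x)) (Q2 (reduced_state dH (2*dH) y))
      = trace_norm (mat m m (\<lambda>(i,j). \<Phi> x y i j))" for x y
    using R unfolding Q1_def Q2_def m_def \<Phi>_def \<Psi>_def cross_map_rank_one R_def
    by (simp add: ptrace2_reduced_state[OF _ assms(2)] U
        fidelity_eq_trace_norm[OF dilated_mat_carrier dilated_mat_carrier])

  \<comment> \<open>\<open>X\<close> is expanded into rank-one terms and \<open>T X\<close> is
    paired with an optimal contraction, whose off-diagonal blocks are again contractions; each term
    is then bounded by \<open>bound\<close> and \<open>bound'\<close>.\<close>
  have upper: "trace_norm (T X) \<le> 2 * s * trace_norm X" if X: "X \<in> carrier_mat (n + n) (n + n)" for X
  proof -
    obtain x y where X_eq: "\<And>i j. i < n + n \<Longrightarrow> j < n + n \<Longrightarrow> X $$ (i,j) = (\<Sum>k<n + n. x k i * cnj (y k j))"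
      and t: "trace_norm X = (\<Sum>k<n + n. vnorm (n + n) (x k) * vnorm (n + n) (y k))"
      using rank_one_decomposition[OF X] by blast
    obtain W where W: "contraction (m + m) (m + m) W"
      and tT: "hs_inner (m + m) (m + m) W (\<lambda>i j. T X $$ (i,j)) = complex_of_real (trace_norm (T X))"
      using trace_norm_attained[OF T] by blast
    let ?W1 = "\<lambda>i j. W i (m + j)" and ?W2 = "\<lambda>i j. W (m + i) j"
    have "\<Psi> (\<lambda>a b. X $$ (a, n + b)) = \<Psi> (\<lambda>a b. \<Sum>k<n + n. x k a * cnj (y k (n + b)))"
      unfolding \<Psi>_def by (rule cross_map_cong) (use R in \<open>auto simp: R_def X_eq simp flip: n_def\<close>)
    then have 1: "hs_inner m m ?W1 (\<Psi> (\<lambda>a b. X $$ (a, n + b)))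
        = (\<Sum>k<n + n. hs_inner m m ?W1 (\<Phi> (x k) (\<lambda>b. y k (n + b))))"
      unfolding \<Phi>_def \<Psi>_def by (simp only: cross_map_sum hs_inner_sum)
    have "\<Psi>' (\<lambda>a b. X $$ (n + a, b)) = \<Psi>' (\<lambda>a b. \<Sum>k<n + n. x k (n + a) * cnj (y k b))"
      unfolding \<Psi>'_def by (rule cross_map_cong) (use R in \<open>auto simp: R_def X_eq simp flip: n_def\<close>)
    then have 2: "hs_inner m m ?W2 (\<Psi>' (\<lambda>a b. X $$ (n + a, b)))
        = (\<Sum>k<n + n. hs_inner m m ?W2 (\<Psi>' (\<lambda>a b. x k (n + a) * cnj (y k b))))"
      unfolding \<Psi>'_def by (simp only: cross_map_sum hs_inner_sum)
    have "trace_norm (T X) = cmod (\<Sum>k<n + n. 2 * (hs_inner m m ?W1 (\<Phi> (x k) (\<lambda>b. y k (n + b)))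
        + hs_inner m m ?W2 (\<Psi>' (\<lambda>a b. x k (n + a) * cnj (y k b)))))"
    proof -
      have "complex_of_real (trace_norm (T X)) = (\<Sum>k<n + n. 2 * (hs_inner m m ?W1 (\<Phi> (x k) (\<lambda>b. y k (n + b)))
        + hs_inner m m ?W2 (\<Psi>' (\<lambda>a b. x k (n + a) * cnj (y k b)))))"
        unfolding tT[symmetric] hsT 1 2 by (simp only: sum_distrib_left sum.distrib distrib_left)
      from arg_cong[OF this, of cmod] show ?thesis by (simp only: norm_of_real abs_of_nonneg[OF trace_norm_nonneg])
    qed
    also have "\<dots> \<le> (\<Sum>k<n + n. 2 * s * (vnorm (n + n) (x k) * vnorm (n + n) (y k)))"
    proof (rule order.trans[OF norm_sum], rule sum_mono)
      fix k
      have "cmod (2 * (hs_inner m m ?W1 (\<Phi> (x k) (\<lambda>b. y k (n + b))) + hs_inner m m ?W2 (\<Psi>' (\<lambda>a b. x k (n + a) * cnj (y k b)))))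
          \<le> 2 * (cmod (hs_inner m m ?W1 (\<Phi> (x k) (\<lambda>b. y k (n + b)))) + cmod (hs_inner m m ?W2 (\<Psi>' (\<lambda>a b. x k (n + a) * cnj (y k b)))))"
        unfolding norm_mult norm_numeral by (intro mult_left_mono norm_triangle_ineq) simp
      also have "\<dots> \<le> 2 * (s * (vnorm n (x k) * vnorm n (\<lambda>b. y k (n + b))) + s * (vnorm n (\<lambda>a. x k (n + a)) * vnorm n (y k)))"
        by (intro mult_left_mono add_mono bound bound' contraction_upper_block contraction_lower_block W) simp
      also have "\<dots> = 2 * s * (vnorm n (x k) * vnorm n (\<lambda>b. y k (n + b)) + vnorm n (\<lambda>a. x k (n + a)) * vnorm n (y k))"
        by (simp add: algebra_simps)
      also have "\<dots> \<le> 2 * s * (vnorm (n + n) (x k) * vnorm (n + n) (y k))"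
        using s0 by (intro mult_left_mono cross_products_le_vnorm) simp
      finally show "cmod (2 * (hs_inner m m ?W1 (\<Phi> (x k) (\<lambda>b. y k (n + b))) + hs_inner m m ?W2 (\<Psi>' (\<lambda>a b. x k (n + a) * cnj (y k b)))))
          \<le> 2 * s * (vnorm (n + n) (x k) * vnorm (n + n) (y k))" .
    qed
    also have "\<dots> = 2 * s * trace_norm X" unfolding t by (rule sum_distrib_left[symmetric])
    finally show ?thesis .
  qed

  \<comment> \<open>The optimal \<open>x\<close> is placed in control sector 0 and \<open>y\<close>
    in sector 1, so only one off-diagonal block of \<open>X\<close> is nonzero.\<close>
  define x' where "x' a = (if a < n then x a else 0)" for a
  define y' where "y' a = (if a < n then 0 else y (a - n))" for a
  define X where "X = mat (n + n) (n + n) (\<lambda>(i,j). x' i * cnj (y' j))"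
  have X: "X \<in> carrier_mat (n + n) (n + n)" by (simp add: X_def)
  have "(\<Sum>i<n. (cmod (x i))\<^sup>2) = 1" "(\<Sum>i<n. (cmod (y i))\<^sup>2) = 1"
    using xy by (simp_all flip: vnorm_sq)
  then have "(vnorm (n + n) x')\<^sup>2 = 1" "(vnorm (n + n) y')\<^sup>2 = 1"
    by (simp_all add: vnorm_sq sum_lessThan_add x'_def y'_def)
  then have "vnorm (n + n) x' = 1" "vnorm (n + n) y' = 1"
    by (blast intro: vnorm_eq_1)+
  then have tX: "trace_norm X = 1" unfolding X_def by (rule trace_norm_rank_one)
  have lower: "2 * s \<le> trace_norm (T X)"
  proof -
    \<comment> \<open>The optimal contraction, extended by zero, reads exactly the block of
      \<open>T X\<close> produced by \<open>\<Phi> x y\<close>.\<close>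
    let ?E = "\<lambda>i j. if i < m \<and> m \<le> j then W i (j - m) else 0"
    have "\<Psi> (\<lambda>a b. X $$ (a, n + b)) = \<Phi> x y"
      unfolding \<Phi>_def \<Psi>_def by (rule cross_map_cong) (use R in \<open>auto simp: R_def X_def x'_def y'_def simp flip: n_def\<close>)
    moreover have "hs_inner m m (\<lambda>i j. ?E (m + i) j) F = 0" for F by (simp add: hs_inner_def)
    moreover have "hs_inner m m (\<lambda>i j. ?E i (m + j)) F = hs_inner m m W F" for F
      by (rule hs_inner_cong) simp_all
    ultimately have "hs_inner (m + m) (m + m) ?E (\<lambda>i j. T X $$ (i,j)) = 2 * hs_inner m m W (\<Phi> x y)"
      unfolding hsT by simp
    then have "2 * s = Re (hs_inner (m + m) (m + m) ?E (\<lambda>i j. T X $$ (i,j)))" by (simp add: s(1))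
    also have "\<dots> \<le> trace_norm (T X)"
      using complex_Re_le_cmod hs_inner_le_trace_norm[OF T contraction_embed_upper_block[OF W]] by (rule order.trans)
    finally show ?thesis .
  qed

  have "diamond_norm (2*dH) (2*dB) (\<lambda>X. C1 X - C2 X) = 2 * s"
    unfolding diamond_norm_def T_def[symmetric] dims
  proof (rule cSup_eq_maximum)
    have "trace_norm (T X) / trace_norm X = 2 * s"
      using lower upper[OF X] tX by simp
    \<comment> \<open>A zero matrix would pair to 0 with every contraction, contradicting trace norm
      1.\<close>
    moreover have "X \<noteq> 0\<^sub>m (n + n) (n + n)"
    proof
      assume "X = 0\<^sub>m (n + n) (n + n)"
      then have "hs_inner (n + n) (n + n) W (\<lambda>i j. X $$ (i,j)) = 0" for W by (simp add: hs_inner_def)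
      then show False using trace_norm_attained[OF X] tX by auto
    qed
    ultimately show "2 * s \<in> {trace_norm (T X) / trace_norm X | X.
        X \<in> carrier_mat (n + n) (n + n) \<and> X \<noteq> 0\<^sub>m (n + n) (n + n)}"
      using X by (metis (mono_tags, lifting) mem_Collect_eq)
  next
    fix r assume "r \<in> {trace_norm (T X) / trace_norm X | X.
        X \<in> carrier_mat (n + n) (n + n) \<and> X \<noteq> 0\<^sub>m (n + n) (n + n)}"
    then obtain X where r: "r = trace_norm (T X) / trace_norm X" and X: "X \<in> carrier_mat (n + n) (n + n)" by blast
    show "r \<le> 2 * s"
    \<comment> \<open>A quotient with denominator 0 equals 0, which \<open>s0\<close>
      bounds.\<close>
    proof (cases "trace_norm X = 0")
      case True
      then show ?thesis using r s0 by simp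
    next
      case False
      then have "trace_norm X > 0" using trace_norm_nonneg[of X] by simp
      then show ?thesis using upper[OF X] r by (simp add: divide_le_eq)
    qed
  qed
  then have half: "diamond_norm (2*dH) (2*dB) (\<lambda>X. C1 X - C2 X) / 2 = s" by simp
  show ?thesis
    unfolding half
  proof (intro conjI exI allI impI)
    show "density dH (reduced_state dH (2*dH) x)" "density dH (reduced_state dH (2*dH) y)"
      using xy by (simp_all add: density_reduced_state n_def)
    show "s = fidelity (Q1 (reduced_state dH (2*dH) x)) (Q2 (reduced_state dH (2*dH) y))"
      unfolding fid s(2) ..
  next
    \<comment> \<open>Purifications of \<open>\<rho>\<close> and \<open>\<sigma>\<close> are unit
      vectors, so \<open>max\<close> applies to them through \<open>fid\<close>.\<close>
    fix \<rho> \<sigma> assume "density dH \<rho> \<and> density dH \<sigma>"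
    then obtain u v where "vnorm n u = 1" "reduced_state dH (2*dH) u = \<rho>" "vnorm n v = 1" "reduced_state dH (2*dH) v = \<sigma>"
      using purification_exists[of dH _ "2*dH"] R unfolding n_def R_def by meson
    then show "fidelity (Q1 \<rho>) (Q2 \<sigma>) \<le> s" using fid[of u v] max[of u v] by simp
  qed
qed

end
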